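(* Let $\{\theta_n\}$ be generated by the PolSA recursion $$\Delta\theta_{n+1}=[I+A]\Delta\theta_n+\alpha_{n+1}[A_{n+1}\theta_n-b_{n+1}],$$ and suppose that (N1), (N2), (N3) of the context hold. Then $$\lim_{n\to\infty}\Sigma_n=\begin{bmatrix}\Sigma_\infty^{11}&0\\0&\Sigma_\infty^{22}\end{bmatrix},$$ where $\Sigma_\infty^{22}\ge0$ is the unique solution to the Lyapunov equation $$\Sigma_\infty^{22}=(I+A)\Sigma_\infty^{22}(I+A)^{T}+\Sigma^{\Delta},$$ and $$\Sigma_\infty^{11}=-\Sigma_\infty^{22}-A^{-1}\Sigma_\infty^{22}-\Sigma_\infty^{22}(A^{-1})^{T}=\Sigma^*:=A^{-1}\Sigma^\Delta (A^{-1})^{T}.$$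
   Context: Linear model: $(A_n,b_n)_{n\ge1}$ is a wide-sense stationary stochastic process with $A_n\in\mathbb{R}^{d\times d}$, $b_n\in\mathbb{R}^d$ and common mean $(A,b)$; $\tilde A_n=A_n-A$, $\tilde b_n=b_n-b$, $\mathcal{F}_n=\sigma\{A_k,b_k:k\le n\}$. The step size is $\alpha_n=1/n$. $\Delta\theta_n=\theta_n-\theta_{n-1}$, with given deterministic initial condition $\theta_0=\theta_{-1}$. $\theta^*$ solves $A\theta^*=b$, $\tilde\theta_n=\theta_n-\theta^*$, $\Delta_n^*=A_n\theta^*-b_n$, and $\Sigma^\Delta=\mathsf{E}[\Delta^*_n(\Delta^*_n)^{T}]$ (independent of $n$). The linear operator $\mathcal{L}:\mathbb{R}^{d\times d}\to\mathbb{R}^{d\times d}$ is $\mathcal{L}(Q)=\mathsf{E}[(I+A_n)Q(I+A_n)^{T}]$. Let $\Phi_n\in\mathbb{R}^{2d}$ be the vector with first block $\sqrt n\,\tilde\theta_n$ and second block $n\Delta\theta_n$ (for the PolSA iterates), and $\Sigma_n=\mathsf{E}[\Phi_n\Phi_n^{T}]=\begin{bmatrix}\Sigma_n^{11}&\Sigma_n^{12}\\\Sigma_n^{21}&\Sigma_n^{22}\end{bmatrix}$ ($d\times d$ blocks). Assumptions: (N1) $\{\tilde A_n,\tilde b_n\}$ are bounded martingale difference sequences (with respect to $\mathcal{F}_n$), and for any matrix $Q$, $\mathsf{E}[(I+A_n)Q(I+A_n)^{T}\mid\mathcal{F}_{n-1}]=\mathcal{L}(Q)$. (N2) Every eigenvalue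 $\lambda$ of $A$ satisfies $\mathrm{Re}(\lambda)<0$ and $|1+\lambda|<1$, and the spectral radius of $\mathcal{L}$ is strictly less than one. (N3) The sequence $\{\Sigma_n\}$ is bounded. *)

theory Defs
  imports "HOL-Analysis.Analysis" "HOL-Probability.Probability"
begin

subsection \<open>Stochastic processes\<close>

text \<open>
  Processes are indexed by \<open>n \<ge> 1\<close>; the value at index \<open>0\<close> is irrelevant.
  Matrices \<open>real ^ 'd ^ 'd\<close>, vectors \<open>real ^ 'd\<close> and their products are Euclidean spaces, so
  expectations are Bochner integrals, and \<open>x \<bullet> u\<close> for \<open>u\<close> in \<open>Basis\<close> ranges over the entries
  of \<open>x\<close>.
\<close>

definition autocov ::
  "'w measure \<Rightarrow> (nat \<Rightarrow> 'w \<Rightarrow> 'e::euclidean_space) \<Rightarrow> nat \<Rightarrow> nat \<Rightarrow> 'e \<Rightarrow> 'e \<Rightarrow> real"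
  where
  "autocov M X m n u v =
     (\<integral>\<omega>. ((X m \<omega> - integral\<^sup>L M (X m)) \<bullet> u) * ((X n \<omega> - integral\<^sup>L M (X n)) \<bullet> v) \<partial>M)"

definition wide_sense_stationary ::
  "'w measure \<Rightarrow> (nat \<Rightarrow> 'w \<Rightarrow> 'e::euclidean_space) \<Rightarrow> bool"
  where
  "wide_sense_stationary M X \<longleftrightarrow>
     (\<forall>n\<ge>1. X n \<in> borel_measurable M \<and> integrable M (\<lambda>\<omega>. (norm (X n \<omega>))\<^sup>2)) \<and>
     (\<forall>m\<ge>1. \<forall>n\<ge>1. integral\<^sup>L M (X m) = integral\<^sup>L M (X n)) \<and>
     (\<forall>m\<ge>1. \<forall>n\<ge>1. \<forall>k. \<forall>u\<in>Basis. \<forall>v\<in>Basis.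
        autocov M X (m + k) (n + k) u v = autocov M X m n u v)"

definition natural_filtration ::
  "'w measure \<Rightarrow> (nat \<Rightarrow> 'w \<Rightarrow> 'e::euclidean_space) \<Rightarrow> nat \<Rightarrow> 'w measure"
  where
  "natural_filtration M X n =
     sigma (space M) {X k -` S \<inter> space M | k S. 1 \<le> k \<and> k \<le> n \<and> S \<in> sets borel}"

text \<open>
  The library has conditional expectations of real random variables only; for vector- and
  matrix-valued ones, they are taken entrywise.
\<close>

definition cond_exp_eq ::
  "'w measure \<Rightarrow> 'w measure \<Rightarrow> ('w \<Rightarrow> 'e::euclidean_space) \<Rightarrow> ('w \<Rightarrow> 'e) \<Rightarrow> bool"
  where
  "cond_exp_eq M F X Y \<longleftrightarrow>
     (\<forall>u\<in>Basis. AE \<omega> in M. real_cond_exp M F (\<lambda>\<omega>. X \<omega> \<bullet> u) \<omega> = Y \<omega> \<bullet> u)"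

definition martingale_difference ::
  "'w measure \<Rightarrow> (nat \<Rightarrow> 'w measure) \<Rightarrow> (nat \<Rightarrow> 'w \<Rightarrow> 'e::euclidean_space) \<Rightarrow> bool"
  where
  "martingale_difference M F X \<longleftrightarrow>
     (\<forall>n\<ge>1. X n \<in> borel_measurable (F n) \<and> integrable M (X n) \<and>
        cond_exp_eq M (F (n - 1)) (X n) (\<lambda>\<omega>. 0))"

definition bounded_process ::
  "'w measure \<Rightarrow> (nat \<Rightarrow> 'w \<Rightarrow> 'e::euclidean_space) \<Rightarrow> bool"
  where
  "bounded_process M X \<longleftrightarrow> (\<exists>C. \<forall>n\<ge>1. AE \<omega> in M. norm (X n \<omega>) \<le> C)"


subsection \<open>Matrices and their spectra\<close>

definition outer :: "real ^ 'm \<Rightarrow> real ^ 'n \<Rightarrow> real ^ 'n ^ 'm"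
  where "outer x y = (\<chi> i j. x $ i * y $ j)"

definition pos_semidef :: "real ^ 'n ^ 'n \<Rightarrow> bool"
  where "pos_semidef S \<longleftrightarrow> transpose S = S \<and> (\<forall>x. 0 \<le> x \<bullet> (S *v x))"

definition block_matrix ::
  "real ^ 'n ^ 'n \<Rightarrow> real ^ 'm ^ 'n \<Rightarrow> real ^ 'n ^ 'm \<Rightarrow> real ^ 'm ^ 'm
     \<Rightarrow> real ^ ('n + 'm) ^ ('n + 'm)"
  where
  "block_matrix P Q R S =
     (\<chi> i j. case i of
        Inl k \<Rightarrow> (case j of Inl l \<Rightarrow> P $ k $ l | Inr l \<Rightarrow> Q $ k $ l)
      | Inr k \<Rightarrow> (case j of Inl l \<Rightarrow> R $ k $ l | Inr l \<Rightarrow> S $ k $ l))"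

text \<open>Eigenvalues of real matrices and of real-linear operators are the complex ones.\<close>

definition mat_eigenvalue :: "real ^ 'n ^ 'n \<Rightarrow> complex \<Rightarrow> bool"
  where
  "mat_eigenvalue B z \<longleftrightarrow>
     (\<exists>v :: complex ^ 'n. v \<noteq> 0 \<and> map_matrix complex_of_real B *v v = z *s v)"

definition complexify_op ::
  "(real ^ 'n ^ 'n \<Rightarrow> real ^ 'n ^ 'n) \<Rightarrow> complex ^ 'n ^ 'n \<Rightarrow> complex ^ 'n ^ 'n"
  where
  "complexify_op T Q =
     (\<chi> i j. Complex (T (map_matrix Re Q) $ i $ j) (T (map_matrix Im Q) $ i $ j))"

definition op_eigenvalue :: "(real ^ 'n ^ 'n \<Rightarrow> real ^ 'n ^ 'n) \<Rightarrow> complex \<Rightarrow> bool"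
  where
  "op_eigenvalue T z \<longleftrightarrow> (\<exists>Q. Q \<noteq> 0 \<and> complexify_op T Q = map_matrix ((*) z) Q)"

definition op_spectral_radius :: "(real ^ 'n ^ 'n \<Rightarrow> real ^ 'n ^ 'n) \<Rightarrow> real"
  where "op_spectral_radius T = Sup {cmod z | z. op_eigenvalue T z}"


subsection \<open>The linear model\<close>

abbreviation filt ::
  "'w measure \<Rightarrow> (nat \<Rightarrow> 'w \<Rightarrow> real ^ 'd ^ 'd) \<Rightarrow> (nat \<Rightarrow> 'w \<Rightarrow> real ^ 'd) \<Rightarrow> nat \<Rightarrow> 'w measure"
  where "filt M A b \<equiv> natural_filtration M (\<lambda>n \<omega>. (A n \<omega>, b n \<omega>))"

text \<open>
  The operator \<open>\<L>\<close> and the matrix \<open>\<Sigma>\<^sup>\<Delta>\<close> are read off at time \<open>1\<close>; by stationarity every other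
  time gives the same value, see \<open>lyap_op_time_invariant\<close> and \<open>noise_cov_time_invariant\<close> below.
\<close>

definition lyap_op :: "'w measure \<Rightarrow> (nat \<Rightarrow> 'w \<Rightarrow> real ^ 'd ^ 'd) \<Rightarrow> real ^ 'd ^ 'd \<Rightarrow> real ^ 'd ^ 'd"
  where
  "lyap_op M A Q = (\<integral>\<omega>. (mat 1 + A 1 \<omega>) ** Q ** transpose (mat 1 + A 1 \<omega>) \<partial>M)"

definition target_noise ::
  "(nat \<Rightarrow> 'w \<Rightarrow> real ^ 'd ^ 'd) \<Rightarrow> (nat \<Rightarrow> 'w \<Rightarrow> real ^ 'd) \<Rightarrow> real ^ 'd \<Rightarrow> nat \<Rightarrow> 'w \<Rightarrow> real ^ 'd"
  where "target_noise A b \<theta>s n \<omega> = A n \<omega> *v \<theta>s - b n \<omega>"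

definition noise_cov ::
  "'w measure \<Rightarrow> (nat \<Rightarrow> 'w \<Rightarrow> real ^ 'd ^ 'd) \<Rightarrow> (nat \<Rightarrow> 'w \<Rightarrow> real ^ 'd) \<Rightarrow> real ^ 'd
     \<Rightarrow> real ^ 'd ^ 'd"
  where
  "noise_cov M A b \<theta>s =
     (\<integral>\<omega>. outer (target_noise A b \<theta>s 1 \<omega>) (target_noise A b \<theta>s 1 \<omega>) \<partial>M)"

text \<open>
  On \<open>nat\<close> we have \<open>0 - 1 = 0\<close>, so the increment at time \<open>0\<close> vanishes: this is the convention
  \<open>\<theta>\<^sub>-\<^sub>1 = \<theta>\<^sub>0\<close>.
\<close>

definition increment :: "(nat \<Rightarrow> 'w \<Rightarrow> real ^ 'd) \<Rightarrow> nat \<Rightarrow> 'w \<Rightarrow> real ^ 'd"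
  where "increment \<theta> n \<omega> = \<theta> n \<omega> - \<theta> (n - 1) \<omega>"

definition scaled_state ::
  "(nat \<Rightarrow> 'w \<Rightarrow> real ^ 'd) \<Rightarrow> real ^ 'd \<Rightarrow> nat \<Rightarrow> 'w \<Rightarrow> real ^ ('d + 'd)"
  where
  "scaled_state \<theta> \<theta>s n \<omega> =
     (\<chi> i. case i of
        Inl k \<Rightarrow> sqrt (real n) * (\<theta> n \<omega> - \<theta>s) $ k
      | Inr k \<Rightarrow> real n * increment \<theta> n \<omega> $ k)"

definition state_cov ::
  "'w measure \<Rightarrow> (nat \<Rightarrow> 'w \<Rightarrow> real ^ 'd) \<Rightarrow> real ^ 'd \<Rightarrow> nat \<Rightarrow> real ^ ('d + 'd) ^ ('d + 'd)"
  where
  "state_cov M \<theta> \<theta>s n =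
     (\<integral>\<omega>. outer (scaled_state \<theta> \<theta>s n \<omega>) (scaled_state \<theta> \<theta>s n \<omega>) \<partial>M)"

definition polsa ::
  "'w measure \<Rightarrow> (nat \<Rightarrow> 'w \<Rightarrow> real ^ 'd ^ 'd) \<Rightarrow> (nat \<Rightarrow> 'w \<Rightarrow> real ^ 'd) \<Rightarrow> real ^ 'd ^ 'd
     \<Rightarrow> real ^ 'd \<Rightarrow> (nat \<Rightarrow> 'w \<Rightarrow> real ^ 'd) \<Rightarrow> bool"
  where
  "polsa M A b Abar \<theta>0 \<theta> \<longleftrightarrow>
     (\<forall>\<omega>\<in>space M. \<theta> 0 \<omega> = \<theta>0 \<and>
        (\<forall>n. increment \<theta> (Suc n) \<omega> =
           (mat 1 + Abar) *v increment \<theta> n \<omega> +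
           (1 / real (Suc n)) *\<^sub>R (A (Suc n) \<omega> *v \<theta> n \<omega> - b (Suc n) \<omega>)))"


subsection \<open>Time invariance\<close>

lemma integrable_mult_of_square:
  fixes f g :: "'w \<Rightarrow> real"
  assumes "f \<in> borel_measurable M" "g \<in> borel_measurable M"
    and "integrable M (\<lambda>\<omega>. (f \<omega>)\<^sup>2)" "integrable M (\<lambda>\<omega>. (g \<omega>)\<^sup>2)"
  shows "integrable M (\<lambda>\<omega>. f \<omega> * g \<omega>)"
proof (rule Bochner_Integration.integrable_bound)
  show "integrable M (\<lambda>\<omega>. (f \<omega>)\<^sup>2 + (g \<omega>)\<^sup>2)"
    using assms by simp
  show "(\<lambda>\<omega>. f \<omega> * g \<omega>) \<in> borel_measurable M"
    using assms by simp
  have "\<bar>x * y\<bar> \<le> x\<^sup>2 + y\<^sup>2" for x y :: real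
    using sum_squares_bound[of "\<bar>x\<bar>" "\<bar>y\<bar>"]
      mult_nonneg_nonneg[OF abs_ge_zero[of x] abs_ge_zero[of y]]
    unfolding abs_mult power2_abs by linarith
  then show "AE \<omega> in M. norm (f \<omega> * g \<omega>) \<le> norm ((f \<omega>)\<^sup>2 + (g \<omega>)\<^sup>2)"
    unfolding real_norm_def by (intro AE_I2) (metis abs_ge_self order_trans)
qed

context
  fixes M :: "'w measure" and X :: "nat \<Rightarrow> 'w \<Rightarrow> 'e::euclidean_space"
  assumes prob: "prob_space M" and wss: "wide_sense_stationary M X"
begin

interpretation prob_space M by (fact prob)

lemma wss_measurable: "n \<ge> 1 \<Longrightarrow> X n \<in> borel_measurable M"
  using wss unfolding wide_sense_stationary_def by blast

lemma wss_square_integrable: "n \<ge> 1 \<Longrightarrow> integrable M (\<lambda>\<omega>. (norm (X n \<omega>))\<^sup>2)"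
  using wss unfolding wide_sense_stationary_def by blast

lemma wss_mean: "m \<ge> 1 \<Longrightarrow> n \<ge> 1 \<Longrightarrow> integral\<^sup>L M (X m) = integral\<^sup>L M (X n)"
  using wss unfolding wide_sense_stationary_def by blast

lemma wss_integrable:
  assumes "n \<ge> 1"
  shows "integrable M (X n)"
proof -
  have meas: "X n \<in> borel_measurable M"
    by (rule wss_measurable[OF assms])
  have "integrable M (\<lambda>\<omega>. norm (X n \<omega>))"
    by (rule square_integrable_imp_integrable[OF measurable_compose[OF meas borel_measurable_norm]
          wss_square_integrable[OF assms]])
  then show ?thesis
    using integrable_norm_iff[OF meas] by (rule iffD1[rotated])
qed

lemma wss_integrable_inner_mult:
  assumes "m \<ge> 1" "n \<ge> 1"
  shows "integrable M (\<lambda>\<omega>. (X m \<omega> \<bullet> u) * (X n \<omega> \<bullet> v))"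
proof -
  have *: "integrable M (\<lambda>\<omega>. (X n \<omega> \<bullet> u)\<^sup>2)" "(\<lambda>\<omega>. X n \<omega> \<bullet> u) \<in> borel_measurable M"
    if n: "n \<ge> 1" for n u
  proof -
    have [measurable]: "X n \<in> borel_measurable M" by (rule wss_measurable[OF n])
    show "(\<lambda>\<omega>. X n \<omega> \<bullet> u) \<in> borel_measurable M" by measurable
    show "integrable M (\<lambda>\<omega>. (X n \<omega> \<bullet> u)\<^sup>2)"
    proof (rule Bochner_Integration.integrable_bound)
      show "integrable M (\<lambda>\<omega>. (norm (X n \<omega>))\<^sup>2 * (norm u)\<^sup>2)"
        using wss_square_integrable[OF n] by simp
      have "(x \<bullet> u)\<^sup>2 \<le> (norm x)\<^sup>2 * (norm u)\<^sup>2" for x :: 'e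
        using Cauchy_Schwarz_ineq[of x u] by (simp only: power2_norm_eq_inner)
      then show "AE \<omega> in M. norm ((X n \<omega> \<bullet> u)\<^sup>2) \<le> norm ((norm (X n \<omega>))\<^sup>2 * (norm u)\<^sup>2)"
        by simp
    qed measurable
  qed
  show ?thesis
    by (rule integrable_mult_of_square[OF *(2)[OF assms(1)] *(2)[OF assms(2)]
          *(1)[OF assms(1)] *(1)[OF assms(2)]])
qed

lemma autocov_eq:
  assumes "m \<ge> 1" "n \<ge> 1"
  shows "autocov M X m n u v =
    (\<integral>\<omega>. (X m \<omega> \<bullet> u) * (X n \<omega> \<bullet> v) \<partial>M) - (integral\<^sup>L M (X m) \<bullet> u) * (integral\<^sup>L M (X n) \<bullet> v)"
proof -
  note [simp] = wss_integrable[OF assms(1)] wss_integrable[OF assms(2)]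
    wss_integrable_inner_mult[OF assms]
  have expand: "((x - a) \<bullet> u) * ((y - c) \<bullet> v) =
      (x \<bullet> u) * (y \<bullet> v) - (c \<bullet> v) * (x \<bullet> u) - (a \<bullet> u) * (y \<bullet> v) + (a \<bullet> u) * (c \<bullet> v)"
    for x a y c :: 'e
    by (simp add: inner_diff_left algebra_simps)
  show ?thesis
    unfolding autocov_def expand by (simp add: prob_space mult.commute)
qed

lemma second_moment_expand:
  assumes "n \<ge> 1"
  shows "(\<integral>\<omega>. (X n \<omega> \<bullet> u) * (X n \<omega> \<bullet> v) \<partial>M) =
    (\<Sum>e\<in>Basis. \<Sum>f\<in>Basis. (u \<bullet> e) * (v \<bullet> f) * (\<integral>\<omega>. (X n \<omega> \<bullet> e) * (X n \<omega> \<bullet> f) \<partial>M))"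
proof -
  have "(X n \<omega> \<bullet> u) * (X n \<omega> \<bullet> v) =
      (\<Sum>e\<in>Basis. \<Sum>f\<in>Basis. (u \<bullet> e) * (v \<bullet> f) * ((X n \<omega> \<bullet> e) * (X n \<omega> \<bullet> f)))" for \<omega>
    unfolding euclidean_inner[of "X n \<omega>" u] euclidean_inner[of "X n \<omega>" v] sum_product
    by (intro sum.cong) auto
  then show ?thesis
    using wss_integrable_inner_mult[OF assms assms] by simp
qed

lemma wss_second_moment:
  assumes "n \<ge> 1"
  shows "(\<integral>\<omega>. (X n \<omega> \<bullet> u) * (X n \<omega> \<bullet> v) \<partial>M) = (\<integral>\<omega>. (X 1 \<omega> \<bullet> u) * (X 1 \<omega> \<bullet> v) \<partial>M)"
proof -
  have eq: "(\<integral>\<omega>. (X n \<omega> \<bullet> e) * (X n \<omega> \<bullet> f) \<partial>M) = (\<integral>\<omega>. (X 1 \<omega> \<bullet> e) * (X 1 \<omega> \<bullet> f) \<partial>M)"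
    if "e \<in> Basis" "f \<in> Basis" for e f
  proof -
    have "\<forall>m\<ge>1. \<forall>n\<ge>1. \<forall>k. \<forall>u\<in>Basis. \<forall>v\<in>Basis.
        autocov M X (m + k) (n + k) u v = autocov M X m n u v"
      using wss unfolding wide_sense_stationary_def by (elim conjE)
    from this[rule_format, OF order_refl order_refl that]
    have "autocov M X (1 + (n - 1)) (1 + (n - 1)) e f = autocov M X 1 1 e f" .
    then have "autocov M X n n e f = autocov M X 1 1 e f"
      unfolding le_add_diff_inverse[OF assms] .
    then show ?thesis
      unfolding autocov_eq[OF assms assms] autocov_eq[OF order_refl order_refl]
        wss_mean[OF assms order_refl] by linarith
  qed
  show ?thesis
    by (subst second_moment_expand[OF assms], subst second_moment_expand[OF order_refl])
      (intro sum.cong refl arg_cong[where f = "(*) _"] eq)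
qed

lemma wss_affine_second_moment:
  assumes "n \<ge> 1"
  shows "integrable M (\<lambda>\<omega>. (c + X n \<omega> \<bullet> u) * (c' + X n \<omega> \<bullet> v))"
    and "(\<integral>\<omega>. (c + X n \<omega> \<bullet> u) * (c' + X n \<omega> \<bullet> v) \<partial>M) =
         (\<integral>\<omega>. (c + X 1 \<omega> \<bullet> u) * (c' + X 1 \<omega> \<bullet> v) \<partial>M)"
proof -
  have expand: "(c + X n \<omega> \<bullet> u) * (c' + X n \<omega> \<bullet> v) =
      c * c' + c * (X n \<omega> \<bullet> v) + c' * (X n \<omega> \<bullet> u) + (X n \<omega> \<bullet> u) * (X n \<omega> \<bullet> v)" for n \<omega>
    by (simp add: algebra_simps)
  have i: "integrable M (\<lambda>\<omega>. X n \<omega> \<bullet> w)" if "n \<ge> 1" for n w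
    using wss_integrable[OF that] by simp
  have int: "integrable M (\<lambda>\<omega>. (c + X n \<omega> \<bullet> u) * (c' + X n \<omega> \<bullet> v))" if "n \<ge> 1" for n
    unfolding expand using i[OF that] wss_integrable_inner_mult[OF that that] by simp
  have val: "(\<integral>\<omega>. (c + X n \<omega> \<bullet> u) * (c' + X n \<omega> \<bullet> v) \<partial>M) =
      c * c' + c * (integral\<^sup>L M (X n) \<bullet> v) + c' * (integral\<^sup>L M (X n) \<bullet> u)
      + (\<integral>\<omega>. (X n \<omega> \<bullet> u) * (X n \<omega> \<bullet> v) \<partial>M)" if "n \<ge> 1" for n
    unfolding expand
    using i[OF that] wss_integrable[OF that] wss_integrable_inner_mult[OF that that]
    by (simp add: prob_space)
  show "integrable M (\<lambda>\<omega>. (c + X n \<omega> \<bullet> u) * (c' + X n \<omega> \<bullet> v))"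
    using int[OF assms] .
  show "(\<integral>\<omega>. (c + X n \<omega> \<bullet> u) * (c' + X n \<omega> \<bullet> v) \<partial>M) =
        (\<integral>\<omega>. (c + X 1 \<omega> \<bullet> u) * (c' + X 1 \<omega> \<bullet> v) \<partial>M)"
    unfolding val[OF assms] val[OF order_refl] wss_mean[OF assms order_refl]
      wss_second_moment[OF assms] ..
qed

end

lemma integral_matrix_eqI:
  fixes F G :: "'w \<Rightarrow> real ^ 'm ^ 'n"
  assumes "\<And>i j. integrable M (\<lambda>\<omega>. F \<omega> $ i $ j)" "\<And>i j. integrable M (\<lambda>\<omega>. G \<omega> $ i $ j)"
    and "\<And>i j. (\<integral>\<omega>. F \<omega> $ i $ j \<partial>M) = (\<integral>\<omega>. G \<omega> $ i $ j \<partial>M)"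
  shows "integrable M F" "integral\<^sup>L M F = integral\<^sup>L M G"
proof -
  have int: "integrable M H" if "\<And>i j. integrable M (\<lambda>\<omega>. H \<omega> $ i $ j)"
    for H :: "'w \<Rightarrow> real ^ 'm ^ 'n"
  proof -
    have "integrable M (\<lambda>\<omega>. \<Sum>u\<in>Basis. (H \<omega> \<bullet> u) *\<^sub>R u)"
      using that by (intro Bochner_Integration.integrable_sum integrable_scaleR_left)
        (auto simp: Basis_vec_def inner_axis)
    then show ?thesis by (simp add: euclidean_representation)
  qed
  have val: "integral\<^sup>L M H $ i $ j = (\<integral>\<omega>. H \<omega> $ i $ j \<partial>M)" if "integrable M H"
    for H :: "'w \<Rightarrow> real ^ 'm ^ 'n" and i j
  proof -
    have "bounded_linear (\<lambda>x :: real ^ 'm ^ 'n. x $ i $ j)"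
      using bounded_linear_compose[OF bounded_linear_vec_nth bounded_linear_vec_nth] .
    from integral_bounded_linear[OF this that] show ?thesis by simp
  qed
  show "integrable M F" by (rule int) fact
  show "integral\<^sup>L M F = integral\<^sup>L M G"
    using assms int by (simp add: vec_eq_iff val)
qed

lemma lyap_op_time_invariant:
  fixes A :: "nat \<Rightarrow> 'w \<Rightarrow> real ^ 'd ^ 'd" and b :: "nat \<Rightarrow> 'w \<Rightarrow> real ^ 'd"
  assumes prob: "prob_space M" and wss: "wide_sense_stationary M (\<lambda>n \<omega>. (A n \<omega>, b n \<omega>))"
    and "n \<ge> 1"
  shows "integrable M (\<lambda>\<omega>. (mat 1 + A n \<omega>) ** Q ** transpose (mat 1 + A n \<omega>))"
    and "(\<integral>\<omega>. (mat 1 + A n \<omega>) ** Q ** transpose (mat 1 + A n \<omega>) \<partial>M) = lyap_op M A Q"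
proof -
  let ?X = "\<lambda>n \<omega>. (A n \<omega>, b n \<omega>)"
  let ?I = "mat 1 :: real ^ 'd ^ 'd"
  let ?u = "\<lambda>i k. (axis i (axis k 1), 0) :: (real ^ 'd ^ 'd) \<times> (real ^ 'd)"
  have entry: "((mat 1 + A n \<omega>) ** Q ** transpose (mat 1 + A n \<omega>)) $ i $ j =
      (\<Sum>l\<in>UNIV. \<Sum>k\<in>UNIV. Q $ k $ l *
        ((?I $ i $ k + ?X n \<omega> \<bullet> ?u i k) * (?I $ j $ l + ?X n \<omega> \<bullet> ?u j l)))" for n \<omega> i j
    by (simp add: matrix_matrix_mult_def transpose_def inner_axis sum_distrib_right)
      (intro sum.cong refl, simp add: algebra_simps)
  note m = wss_affine_second_moment[OF prob wss]
  have int: "integrable M (\<lambda>\<omega>. ((mat 1 + A n \<omega>) ** Q ** transpose (mat 1 + A n \<omega>)) $ i $ j)"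
    if "n \<ge> 1" for n i j
    unfolding entry by (intro Bochner_Integration.integrable_sum integrable_mult_right m(1)[OF that])
  have val: "(\<integral>\<omega>. ((mat 1 + A n \<omega>) ** Q ** transpose (mat 1 + A n \<omega>)) $ i $ j \<partial>M) =
      (\<Sum>l\<in>UNIV. \<Sum>k\<in>UNIV. Q $ k $ l *
        (\<integral>\<omega>. (?I $ i $ k + ?X n \<omega> \<bullet> ?u i k) * (?I $ j $ l + ?X n \<omega> \<bullet> ?u j l) \<partial>M))"
    if "n \<ge> 1" for n i j
    unfolding entry
    by (simp only: Bochner_Integration.integral_sum Bochner_Integration.integrable_sum
        integrable_mult_right m(1)[OF that] integral_mult_right_zero)
  have eq: "(\<integral>\<omega>. ((mat 1 + A n \<omega>) ** Q ** transpose (mat 1 + A n \<omega>)) $ i $ j \<partial>M) =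
      (\<integral>\<omega>. ((mat 1 + A 1 \<omega>) ** Q ** transpose (mat 1 + A 1 \<omega>)) $ i $ j \<partial>M)" for i j
    unfolding val[OF assms(3)] val[OF order_refl] m(2)[OF assms(3)] ..
  show "integrable M (\<lambda>\<omega>. (mat 1 + A n \<omega>) ** Q ** transpose (mat 1 + A n \<omega>))"
    and "(\<integral>\<omega>. (mat 1 + A n \<omega>) ** Q ** transpose (mat 1 + A n \<omega>) \<partial>M) = lyap_op M A Q"
    unfolding lyap_op_def
    by (rule integral_matrix_eqI[OF int[OF assms(3)] int[OF order_refl] eq])+
qed

lemma noise_cov_time_invariant:
  fixes A :: "nat \<Rightarrow> 'w \<Rightarrow> real ^ 'd ^ 'd" and b :: "nat \<Rightarrow> 'w \<Rightarrow> real ^ 'd"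
  assumes prob: "prob_space M" and wss: "wide_sense_stationary M (\<lambda>n \<omega>. (A n \<omega>, b n \<omega>))"
    and "n \<ge> 1"
  shows "integrable M (\<lambda>\<omega>. outer (target_noise A b \<theta>s n \<omega>) (target_noise A b \<theta>s n \<omega>))"
    and "(\<integral>\<omega>. outer (target_noise A b \<theta>s n \<omega>) (target_noise A b \<theta>s n \<omega>) \<partial>M) = noise_cov M A b \<theta>s"
proof -
  let ?X = "\<lambda>n \<omega>. (A n \<omega>, b n \<omega>)"
  let ?u = "\<lambda>i. (axis i \<theta>s, - axis i 1) :: (real ^ 'd ^ 'd) \<times> (real ^ 'd)"
  have comp: "target_noise A b \<theta>s n \<omega> $ i = 0 + ?X n \<omega> \<bullet> ?u i" for n \<omega> i
    by (simp add: target_noise_def inner_axis matrix_vector_mul_component)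
  note m = wss_affine_second_moment[OF prob wss]
  have entry: "outer (target_noise A b \<theta>s n \<omega>) (target_noise A b \<theta>s n \<omega>) $ i $ j =
      (0 + ?X n \<omega> \<bullet> ?u i) * (0 + ?X n \<omega> \<bullet> ?u j)" for n \<omega> i j
    unfolding comp[symmetric] by (simp add: outer_def)
  have int: "integrable M (\<lambda>\<omega>. outer (target_noise A b \<theta>s n \<omega>) (target_noise A b \<theta>s n \<omega>) $ i $ j)"
    if "n \<ge> 1" for n i j
    unfolding entry by (rule m(1)[OF that])
  have eq: "(\<integral>\<omega>. outer (target_noise A b \<theta>s n \<omega>) (target_noise A b \<theta>s n \<omega>) $ i $ j \<partial>M) =
      (\<integral>\<omega>. outer (target_noise A b \<theta>s 1 \<omega>) (target_noise A b \<theta>s 1 \<omega>) $ i $ j \<partial>M)" for i j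
    unfolding entry by (rule m(2)[OF assms(3)])
  show "integrable M (\<lambda>\<omega>. outer (target_noise A b \<theta>s n \<omega>) (target_noise A b \<theta>s n \<omega>))"
    and "(\<integral>\<omega>. outer (target_noise A b \<theta>s n \<omega>) (target_noise A b \<theta>s n \<omega>) \<partial>M) = noise_cov M A b \<theta>s"
    unfolding noise_cov_def
    by (rule integral_matrix_eqI[OF int[OF assms(3)] int[OF order_refl] eq])+
qed

end

theory Submission
  imports Defs "HOL-Computational_Algebra.Fundamental_Theorem_Algebra" "HOL-Real_Asymp.Real_Asymp"
begin

text \<open>
  Write \<open>G = I + A\<close>, \<open>x\<^sub>n = \<theta>\<^sub>n - \<theta>*\<close>, \<open>y\<^sub>n = \<surd>n x\<^sub>n\<close>, \<open>v\<^sub>n = n \<Delta>\<theta>\<^sub>n\<close>, and let \<open>W\<^sub>n\<close> be the martingale difference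
  part of \<open>A\<^sub>n \<theta>\<^sub>n\<^sub>-\<^sub>1 - b\<^sub>n\<close>. Then \<open>v\<^sub>n\<^sub>+\<^sub>1 = G v\<^sub>n + W\<^sub>n\<^sub>+\<^sub>1 + o(1)\<close> in \<open>L\<^sup>2\<close>, with \<open>W\<^sub>n\<^sub>+\<^sub>1\<close> orthogonal to the past and
  of covariance tending to \<open>\<Sigma>\<^sup>\<Delta>\<close>, because (N3) forces \<open>x\<^sub>n \<rightarrow> 0\<close> in \<open>L\<^sup>2\<close>. So the lower diagonal block obeys a
  perturbed Lyapunov recursion, and the off-diagonal block \<open>C\<^sub>n = E[y\<^sub>n v\<^sub>n\<^sup>T]\<close> obeys
  \<open>C\<^sub>n\<^sub>+\<^sub>1 = C\<^sub>n G\<^sup>T + o(1)\<close>; both converge since the powers of \<open>G\<close> tend to zero. Summation by parts gives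
  \<open>W\<^sub>2 + \<dots> + W\<^sub>n = - A n x\<^sub>n + O(1)\<close>, so \<open>A E[y\<^sub>n y\<^sub>n\<^sup>T] A\<^sup>T\<close> is asymptotically the Cesaro mean of the covariances
  of the \<open>W\<^sub>k\<close>, that is, \<open>\<Sigma>\<^sup>\<Delta>\<close>.
\<close>

subsection \<open>Matrix and outer products as bounded bilinear maps\<close>

lemma bounded_bilinear_matrix_mult:
  "bounded_bilinear ((**) :: real ^ 'n ^ 'm \<Rightarrow> real ^ 'k ^ 'n \<Rightarrow> real ^ 'k ^ 'm)"
  unfolding bilinear_conv_bounded_bilinear[symmetric] bilinear_def
  by (auto intro!: linearI simp: matrix_add_ldistrib matrix_matrix_mult_def vec_eq_iff
      sum.distrib sum_distrib_left algebra_simps)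

lemma bounded_bilinear_matrix_vector_mult:
  "bounded_bilinear ((*v) :: real ^ 'n ^ 'm \<Rightarrow> real ^ 'n \<Rightarrow> real ^ 'm)"
  unfolding bilinear_conv_bounded_bilinear[symmetric] bilinear_def
  by (auto intro!: linearI simp: matrix_vector_mult_def vec_eq_iff
      sum.distrib sum_distrib_left algebra_simps)

lemma bounded_bilinear_outer:
  "bounded_bilinear (outer :: real ^ 'm \<Rightarrow> real ^ 'n \<Rightarrow> real ^ 'n ^ 'm)"
  unfolding bilinear_conv_bounded_bilinear[symmetric] bilinear_def
  by (auto intro!: linearI simp: outer_def vec_eq_iff algebra_simps)

lemma bounded_linear_transpose:
  "bounded_linear (transpose :: real ^ 'n ^ 'm \<Rightarrow> real ^ 'm ^ 'n)"
  unfolding linear_conv_bounded_linear[symmetric]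
  by (auto intro!: linearI simp: transpose_def vec_eq_iff)

lemmas tendsto_matrix_mult = bounded_bilinear.tendsto[OF bounded_bilinear_matrix_mult]
lemmas tendsto_transpose = bounded_linear.tendsto[OF bounded_linear_transpose]

lemma tendsto_matrix_entryI:
  fixes X :: "nat \<Rightarrow> 'a::topological_space ^ 'n ^ 'm"
  assumes "\<And>i j. (\<lambda>n. X n $ i $ j) \<longlonglongrightarrow> L $ i $ j"
  shows "X \<longlonglongrightarrow> L"
  using assms by (intro vec_tendstoI)

lemma transpose_add: "transpose (X + Y) = transpose X + transpose Y"
  by (simp add: transpose_def vec_eq_iff)

subsection \<open>Asymptotically autonomous linear recursions\<close>

text \<open>Compare \<open>X (n + k)\<close> with the unperturbed iterate
  \<open>(T ^^ k) (X n)\<close>. For fixed \<open>k\<close> only finitely many perturbations enter,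
  so the difference vanishes as \<open>n\<close> grows; boundedness of \<open>X\<close> makes the
  iterate itself small once \<open>k\<close> is large. Hence \<open>k\<close> is chosen first and
  \<open>n\<close> afterwards.\<close>

lemma bounded_perturbed_recursion_tendsto_0:
  fixes X :: "nat \<Rightarrow> 'a::real_normed_vector"
  assumes T: "bounded_linear T"
    and c: "\<And>k x. norm ((T ^^ k) x) \<le> c k * norm x" "c \<longlonglongrightarrow> 0"
    and bdd: "\<And>n. norm (X n) \<le> B"
    and rec: "(\<lambda>n. X (Suc n) - T (X n)) \<longlonglongrightarrow> 0"
  shows "X \<longlonglongrightarrow> 0"
proof (rule metric_LIMSEQ_I)
  fix e :: real assume "e > 0"
  have lin: "linear T" using T by (rule bounded_linear.linear)
  \<comment> \<open>The error after \<open>k + 1\<close> steps is the newest perturbation plus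
    \<open>T\<close> applied to the error after \<open>k\<close> steps.\<close>
  have iter: "(\<lambda>n. X (n + k) - (T ^^ k) (X n)) \<longlonglongrightarrow> 0" for k
  proof (induction k)
    case (Suc k)
    have "(\<lambda>n. (X (Suc (n + k)) - T (X (n + k))) + T (X (n + k) - (T ^^ k) (X n)))
        \<longlonglongrightarrow> 0 + T 0"
      by (intro tendsto_add bounded_linear.tendsto[OF T] Suc)
        (rule LIMSEQ_ignore_initial_segment[OF rec])
    then show ?case
      by (simp add: linear_diff[OF lin] linear_0[OF lin])
  qed simp
  have "(\<lambda>k. c k * B) \<longlonglongrightarrow> 0 * B" by (intro tendsto_intros c)
  then obtain k where k: "c k * B < e / 2"
    using order_tendstoD(2)[of "\<lambda>k. c k * B" 0 sequentially "e / 2"] \<open>e > 0\<close>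
    by (auto simp: eventually_sequentially)
  \<comment> \<open>The sign of \<open>c k\<close> is not given in advance; the bound forces it to
    be nonnegative as soon as it is tested at a nonzero point.\<close>
  have c0: "c k \<ge> 0 \<or> norm (X n) = 0" for n
    using c(1)[of k "X n"] norm_ge_zero[of "(T ^^ k) (X n)"]
    by (metis norm_ge_zero order_trans zero_le_mult_iff order_antisym)
  obtain N where N: "\<And>n. n \<ge> N \<Longrightarrow> norm (X (n + k) - (T ^^ k) (X n)) < e / 2"
    using LIMSEQ_D[OF iter[of k], of "e / 2"] \<open>e > 0\<close> by auto
  have "norm (X (n + k)) < e" if "n \<ge> N" for n
  proof -
    have "norm ((T ^^ k) (X n)) < e / 2"
    proof (cases "norm (X n) = 0")
      case True then show ?thesis using c(1)[of k "X n"] \<open>e > 0\<close> by simp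
    next
      case False
      then have "c k * norm (X n) \<le> c k * B" using c0 bdd by (intro mult_left_mono) auto
      then show ?thesis using c(1)[of k "X n"] k by linarith
    qed
    then show ?thesis
      using N[OF that] norm_triangle_sub[of "X (n + k)" "(T ^^ k) (X n)"] by linarith
  qed
  then have "norm (X n) < e" if "n \<ge> N + k" for n
    using that by (metis add_leE le_add_diff_inverse2 nat_le_linear add_le_cancel_right)
  then show "\<exists>no. \<forall>n\<ge>no. dist (X n) 0 < e" by auto
qed

text \<open>Boundedness has to be derived first: \<open>cmod z < 1\<close> keeps each component
  inside a fixed disc. Then the perturbed recursion lemma applies componentwise, with
  \<open>T\<close> the multiplication by \<open>z\<close> and
  \<open>c k = cmod z ^ k\<close>.\<close>

lemma scalar_recursion_tendsto_0:
  fixes x :: "nat \<Rightarrow> complex ^ 'n"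
  assumes z: "cmod z < 1" and rec: "(\<lambda>n. x (Suc n) - z *s x n) \<longlonglongrightarrow> 0"
  shows "x \<longlonglongrightarrow> 0"
proof (rule vec_tendstoI)
  fix i
  define u where "u n = cmod (x n $ i)" for n
  define d where "d n = cmod ((x (Suc n) - z *s x n) $ i)" for n
  have d: "d \<longlonglongrightarrow> 0"
    unfolding d_def using tendsto_norm[OF tendsto_vec_nth[OF rec, of i]] by simp
  have u: "u (Suc n) \<le> cmod z * u n + d n" for n
    unfolding u_def d_def
    using norm_triangle_sub[of "x (Suc n) $ i" "z * x n $ i"] by (simp add: norm_mult)
  obtain D where D: "\<And>n. d n \<le> D"
    using convergent_imp_Bseq[OF convergentI[OF d]] by (metis BseqE abs_le_D1 real_norm_def)
  have "d 0 \<ge> 0" by (simp add: d_def)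
  then have "D \<ge> 0" using D[of 0] by linarith
  \<comment> \<open>The second argument of \<open>max\<close> gives
    \<open>D \<le> (1 - cmod z) * K\<close>, so the bound \<open>K\<close> reproduces itself under
    \<open>u\<close>.\<close>
  define K where "K = max (u 0) (D / (1 - cmod z))"
  have bdd: "u n \<le> K" for n
  proof (induction n)
    case (Suc n)
    have "D / (1 - cmod z) \<le> K" by (simp add: K_def)
    then have "D \<le> (1 - cmod z) * K" using z by (simp add: pos_divide_le_eq mult.commute)
    moreover have "cmod z * u n \<le> cmod z * K" using Suc by (intro mult_left_mono) auto
    ultimately show ?case using u[of n] D[of n] by (simp add: algebra_simps)
  qed (simp add: K_def)
  have "(\<lambda>n. x n $ i) \<longlonglongrightarrow> 0"
  proof (rule bounded_perturbed_recursion_tendsto_0)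
    show "bounded_linear ((*) z)" by (rule bounded_linear_mult_right)
    have "(((*) z) ^^ k) y = z ^ k * y" for k y by (induction k) auto
    then show "norm ((((*) z) ^^ k) y) \<le> cmod z ^ k * norm y" for k y
      by (simp add: norm_mult norm_power)
    show "(\<lambda>k. cmod z ^ k) \<longlonglongrightarrow> 0" using z by (intro LIMSEQ_realpow_zero) auto
    show "norm (x n $ i) \<le> K" for n using bdd[of n] by (simp add: u_def)
    show "(\<lambda>n. x (Suc n) $ i - z * x n $ i) \<longlonglongrightarrow> 0"
      using tendsto_vec_nth[OF rec, of i] by simp
  qed
  then show "(\<lambda>n. x n $ i) \<longlonglongrightarrow> 0 $ i" by simp
qed

subsection \<open>Powers of a matrix with spectral radius below one\<close>

text \<open>This is the difference operator p(E) applied to the sequence \<open>x\<close>, with E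
  the forward shift; products of polynomials become compositions of such operators.\<close>

definition shift_poly :: "complex poly \<Rightarrow> (nat \<Rightarrow> complex ^ 'n) \<Rightarrow> nat \<Rightarrow> complex ^ 'n"
  where "shift_poly p x n = (\<chi> i. \<Sum>k\<le>degree p. coeff p k * x (n + k) $ i)"

lemma shift_poly_0 [simp]: "shift_poly 0 x n = 0"
  by (simp add: shift_poly_def vec_eq_iff)

text \<open>Padding with zero coefficients brings polynomials of different degrees to a common
  summation range.\<close>

lemma shift_poly_eq:
  assumes "degree p \<le> m"
  shows "shift_poly p x n = (\<chi> i. \<Sum>k\<le>m. coeff p k * x (n + k) $ i)"
proof -
  have "(\<Sum>k\<le>degree p. coeff p k * x (n + k) $ i) = (\<Sum>k\<le>m. coeff p k * x (n + k) $ i)" for i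
    using assms by (intro sum.mono_neutral_left) (auto simp: coeff_eq_0)
  then show ?thesis by (simp add: shift_poly_def)
qed

lemma shift_poly_pCons: "shift_poly (pCons a p) x n = a *s x n + shift_poly p x (Suc n)"
  by (simp add: shift_poly_eq[OF degree_pCons_le] shift_poly_def vec_eq_iff
      sum.atMost_Suc_shift del: sum.atMost_Suc)

lemma shift_poly_add: "shift_poly (p + q) x n = shift_poly p x n + shift_poly q x n"
proof -
  have "degree p \<le> max (degree p) (degree q)" "degree q \<le> max (degree p) (degree q)" by auto
  note * = shift_poly_eq[OF degree_add_le_max] this[THEN shift_poly_eq]
  show ?thesis unfolding * by (simp add: vec_eq_iff sum.distrib algebra_simps)
qed

lemma shift_poly_smult: "shift_poly (smult a p) x n = a *s shift_poly p x n"
  unfolding shift_poly_eq[OF degree_smult_le]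
  by (simp add: shift_poly_def vec_eq_iff sum_distrib_left mult.assoc)

lemma shift_poly_linear_factor:
  "shift_poly ([:-z, 1:] * q) x n = shift_poly q x (Suc n) - z *s shift_poly q x n"
proof -
  have "[:-z, 1:] * q = pCons 0 q + smult (- z) q" by simp
  then show ?thesis
    by (simp only: shift_poly_add shift_poly_smult shift_poly_pCons) (simp add: vec_eq_iff)
qed

text \<open>By linearity \<open>G\<close> commutes with polynomials in the shift, so
  \<open>shift_poly p x\<close> is again an orbit of \<open>G\<close>.\<close>

lemma shift_poly_matrix:
  fixes G :: "complex ^ 'n ^ 'n"
  assumes "\<And>n. x (Suc n) = G *v x n"
  shows "shift_poly p x (Suc n) = G *v shift_poly p x n"
  by (induction p arbitrary: n)
    (simp_all add: shift_poly_pCons assms matrix_vector_right_distrib vector_scalar_commute)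

text \<open>Linear factors \<open>X - z\<close> are stripped off one by one: for \<open>|z| < 1\<close> the scalar recursion with
  multiplier \<open>z\<close> contracts, otherwise \<open>G - z\<close> is invertible.\<close>

lemma tendsto_shift_poly_imp_tendsto:
  fixes G :: "complex ^ 'n ^ 'n"
  assumes eig: "\<And>z v. v \<noteq> 0 \<Longrightarrow> G *v v = z *s v \<Longrightarrow> cmod z < 1"
    and rec: "\<And>n. x (Suc n) = G *v x n"
    and "p \<noteq> 0" and lim: "shift_poly p x \<longlonglongrightarrow> 0"
  shows "x \<longlonglongrightarrow> 0"
  using assms(3,4)
proof (induction "degree p" arbitrary: p)
  case 0
  then obtain a where p: "p = [:a:]" "a \<noteq> 0" by (metis degree_0_id pCons_0_0 degree_eq_zeroE)
  have "shift_poly p x n = a *s x n" for n unfolding p by (simp add: shift_poly_pCons)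
  then have "shift_poly p x = (\<lambda>n. a *s x n)" by (rule ext)
  then have "(\<lambda>n. a *s x n) \<longlonglongrightarrow> 0" using 0(3) by simp
  then have *: "(\<lambda>n. a * x n $ i) \<longlonglongrightarrow> 0" for i using tendsto_vec_nth[of _ 0 _ i] by fastforce
  have "(\<lambda>n. inverse a * (a * x n $ i)) \<longlonglongrightarrow> inverse a * 0" for i by (intro tendsto_intros *)
  then have "(\<lambda>n. x n $ i) \<longlonglongrightarrow> 0" for i using p(2) by (simp add: mult.assoc[symmetric])
  then show ?case by (intro vec_tendstoI) simp
next
  case (Suc m)
  have "\<not> constant (poly p)" using Suc(2) by (simp add: constant_degree)
  then obtain z where "poly p z = 0" using fundamental_theorem_of_algebra by blast
  then obtain q where q: "p = [:-z, 1:] * q" by (metis dvdE poly_eq_0_iff_dvd)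
  have "q \<noteq> 0" using q Suc.prems by auto
  then have deg: "degree p = Suc (degree q)" unfolding q by (subst degree_mult_eq) auto
  let ?y = "shift_poly q x"
  have y: "(\<lambda>n. ?y (Suc n) - z *s ?y n) \<longlonglongrightarrow> 0"
    using Suc.prems(2) unfolding q shift_poly_linear_factor[abs_def] .
  have "?y \<longlonglongrightarrow> 0"
  proof (cases "cmod z < 1")
    case True then show ?thesis using y by (rule scalar_recursion_tendsto_0)
  next
    case False
    have H: "(G - mat z) *v v = G *v v - z *s v" for v
      by (simp add: vec_eq_iff matrix_vector_mult_def mat_def left_diff_distrib sum_subtractf
        if_distrib[where f = "\<lambda>t. t * _"] cong: if_cong)
    \<comment> \<open>As \<open>?y\<close> is an orbit of \<open>G\<close>, the null sequence in
      \<open>y\<close> is \<open>(G - mat z) *v ?y n\<close>. Its matrix has trivial kernel because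
      \<open>z\<close> is too large to be an eigenvalue, and a left inverse then recovers
      \<open>?y\<close> itself.\<close>
    have "\<forall>v. (G - mat z) *v v = 0 \<longrightarrow> v = 0"
      using eig[of _ z] False unfolding H by auto
    then obtain B where B: "B ** (G - mat z) = mat 1" using matrix_left_invertible_ker by blast
    have "(\<lambda>n. B *v (?y (Suc n) - z *s ?y n)) \<longlonglongrightarrow> B *v 0"
      by (rule bounded_linear.tendsto[OF matrix_vector_mul_bounded_linear y])
    then show ?thesis
      by (simp add: shift_poly_matrix[of x G, OF rec] H[symmetric] matrix_vector_mul_assoc B)
  qed
  then show ?case using Suc.hyps \<open>q \<noteq> 0\<close> deg by auto
qed

text \<open>One vector more than the dimension forces dependence. If \<open>f\<close> repeats a
  value, its image may be too small for the dimension count, but then the difference of the two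
  equal terms is already a relation.\<close>

lemma ex_linear_relation:
  fixes f :: "nat \<Rightarrow> 'a::euclidean_space"
  shows "\<exists>c. (\<exists>k\<le>DIM('a). c k \<noteq> 0) \<and> (\<Sum>k\<le>DIM('a). c k *\<^sub>R f k) = 0"
proof (cases "inj_on f {..DIM('a)}")
  case True
  have "dependent (f ` {..DIM('a)})"
    by (rule dependent_biggerset) (simp add: card_image[OF True])
  then obtain u where u: "\<exists>v\<in>f ` {..DIM('a)}. u v \<noteq> 0" "(\<Sum>v\<in>f ` {..DIM('a)}. u v *\<^sub>R v) = 0"
    using dependent_finite[of "f ` {..DIM('a)}"] by auto
  have "(\<Sum>k\<le>DIM('a). u (f k) *\<^sub>R f k) = 0"
    using u(2) by (simp add: sum.reindex[OF True])
  then show ?thesis using u(1) by (intro exI[of _ "u \<circ> f"]) auto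
next
  case False
  then obtain i j where ij: "i \<le> DIM('a)" "j \<le> DIM('a)" "i \<noteq> j" "f i = f j"
    by (auto simp: inj_on_def)
  let ?c = "\<lambda>k. if k = i then 1 else if k = j then -1 else (0::real)"
  have "(\<Sum>k\<le>DIM('a). ?c k *\<^sub>R f k) = (\<Sum>k\<in>{i, j}. ?c k *\<^sub>R f k)"
    using ij by (intro sum.mono_neutral_right) auto
  also have "\<dots> = 0" using ij by auto
  finally show ?thesis using ij by (intro exI[of _ ?c]) auto
qed

text \<open>A linear relation among the first iterates is a nonzero polynomial in the shift that
  annihilates the orbit at index \<open>0\<close>, hence at every index since the result is again an
  orbit of \<open>G\<close>. This plays the part of the Cayley-Hamilton theorem; stripping the
  linear factors does the rest.\<close>

lemma complex_matrix_orbit_tendsto_0: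
  fixes G :: "complex ^ 'n ^ 'n"
  assumes eig: "\<And>z v. v \<noteq> 0 \<Longrightarrow> G *v v = z *s v \<Longrightarrow> cmod z < 1"
  shows "(\<lambda>n. (((*v) G) ^^ n) v) \<longlonglongrightarrow> 0"
proof -
  define x where "x n = (((*v) G) ^^ n) v" for n
  have rec: "x (Suc n) = G *v x n" for n by (simp add: x_def)
  \<comment> \<open>This is the real dimension, twice the number of components; the degree is
    irrelevant as long as the polynomial is nonzero.\<close>
  let ?m = "DIM(complex ^ 'n)"
  obtain c where c: "\<exists>k\<le>?m. c k \<noteq> 0" "(\<Sum>k\<le>?m. c k *\<^sub>R x k) = 0"
    using ex_linear_relation[of x] by blast
  define p where "p = (\<Sum>k\<le>?m. monom (complex_of_real (c k)) k)"
  have coeff: "coeff p k = (if k \<le> ?m then complex_of_real (c k) else 0)" for k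
    by (simp add: p_def coeff_sum)
  have "p \<noteq> 0" using c(1) coeff by (metis coeff_0 of_real_eq_0_iff)
  have deg: "degree p \<le> ?m" by (rule degree_le) (simp add: coeff)
  have "shift_poly p x 0 $ i = (\<Sum>k\<le>?m. c k *\<^sub>R x k) $ i" for i
    unfolding shift_poly_eq[OF deg] by (simp add: coeff scaleR_conv_of_real[where 'a = complex])
  then have "shift_poly p x 0 = 0" using c(2) by (simp add: vec_eq_iff)
  then have "shift_poly p x n = 0" for n
    by (induction n) (simp_all add: shift_poly_matrix[of x G, OF rec])
  then have "shift_poly p x \<longlonglongrightarrow> 0" by (simp add: tendsto_eventually)
  from tendsto_shift_poly_imp_tendsto[OF eig rec \<open>p \<noteq> 0\<close> this] show ?thesis
    unfolding x_def .
qed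

section \<open>Powers of a real matrix, its eigenvalues and its inverse\<close>

definition mat_power :: "real ^ 'n ^ 'n \<Rightarrow> nat \<Rightarrow> real ^ 'n ^ 'n"
  where "mat_power G k = (((**) G) ^^ k) (mat 1)"

lemma mat_power_0 [simp]: "mat_power G 0 = mat 1"
  and mat_power_Suc [simp]: "mat_power G (Suc k) = G ** mat_power G k"
  by (simp_all add: mat_power_def)

text \<open>Column \<open>j\<close> of the \<open>k\<close>-th power is the orbit of the
  \<open>j\<close>-th unit vector under the complexified matrix, where the eigenvalue condition can
  be used.\<close>

lemma mat_power_tendsto_0:
  fixes G :: "real ^ 'n ^ 'n"
  assumes eig: "\<And>z. mat_eigenvalue G z \<Longrightarrow> cmod z < 1"
  shows "mat_power G \<longlonglongrightarrow> 0"
proof (rule tendsto_matrix_entryI)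
  fix i j
  let ?G = "map_matrix complex_of_real G"
  let ?e = "axis j 1 :: complex ^ 'n"
  have orb: "(((*v) ?G) ^^ k) ?e $ i = complex_of_real (mat_power G k $ i $ j)" for k i
  proof (induction k arbitrary: i)
    case 0 show ?case by (auto simp: axis_def mat_def)
  next
    case (Suc k) then show ?case by (simp add: matrix_vector_mult_def matrix_matrix_mult_def)
  qed
  have "(\<lambda>k. (((*v) ?G) ^^ k) ?e) \<longlonglongrightarrow> 0"
    by (rule complex_matrix_orbit_tendsto_0) (use eig in \<open>auto simp: mat_eigenvalue_def\<close>)
  from tendsto_Re[OF tendsto_vec_nth[OF this, of i]]
  show "(\<lambda>k. mat_power G k $ i $ j) \<longlonglongrightarrow> 0 $ i $ j" by (simp add: orb)
qed

text \<open>Translates the condition of (N2) on 1 + \<lambda> into a spectral bound for I +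
  A.\<close>

lemma mat_eigenvalue_mat_1_plus:
  "mat_eigenvalue (mat 1 + B) z \<longleftrightarrow> mat_eigenvalue B (z - 1)"
proof -
  have "map_matrix complex_of_real (mat 1 + B) *v v = v + map_matrix complex_of_real B *v v" for v
  proof -
    have "map_matrix complex_of_real (mat 1 + B) = mat 1 + map_matrix complex_of_real B"
      by (simp add: vec_eq_iff mat_def)
    then show ?thesis by (simp add: matrix_vector_mult_add_rdistrib)
  qed
  moreover have "v + w = z *s v \<longleftrightarrow> w = (z - 1) *s v" for v w :: "complex ^ 'a"
    by (auto simp: vec_eq_iff algebra_simps)
  ultimately show ?thesis unfolding mat_eigenvalue_def by simp
qed

text \<open>A nonzero real kernel vector, read as a complex one, would be an eigenvector for the
  eigenvalue zero.\<close>

lemma matrix_inv_if_no_zero_eigenvalue: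
  fixes B :: "real ^ 'n ^ 'n"
  assumes "\<not> mat_eigenvalue B 0"
  shows "matrix_inv B ** B = mat 1" "B ** matrix_inv B = mat 1"
proof -
  have "v = 0" if "B *v v = 0" for v
  proof (rule ccontr)
    assume "v \<noteq> 0"
    let ?v = "(\<chi> i. complex_of_real (v $ i))"
    have "map_matrix complex_of_real B *v ?v = (\<chi> i. complex_of_real ((B *v v) $ i))"
      by (simp add: vec_eq_iff matrix_vector_mult_def)
    then have "map_matrix complex_of_real B *v ?v = 0 *s ?v" using that by (simp add: vec_eq_iff)
    moreover have "?v \<noteq> 0" using \<open>v \<noteq> 0\<close> by (simp add: vec_eq_iff)
    ultimately show False using assms unfolding mat_eigenvalue_def by blast
  qed
  then have "invertible B"
    using matrix_left_invertible_ker[of B] matrix_left_right_inverse[of _ B]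
    unfolding invertible_def by blast
  then have "\<exists>A'. B ** A' = mat 1 \<and> A' ** B = mat 1" by (simp add: invertible_def)
  from someI_ex[OF this] show "matrix_inv B ** B = mat 1" "B ** matrix_inv B = mat 1"
    by (simp_all add: matrix_inv_def)
qed

subsection \<open>Lyapunov equations\<close>

lemma lyapunov_iterate:
  fixes G X :: "real ^ 'n ^ 'n"
  shows
  "((\<lambda>X. G ** X ** transpose G) ^^ k) X = mat_power G k ** X ** transpose (mat_power G k)"
  by (induction k) (simp_all add: matrix_transpose_mul matrix_mul_assoc)

lemma right_mult_iterate:
  fixes G X :: "real ^ 'n ^ 'n"
  shows
  "((\<lambda>X. X ** transpose G) ^^ k) X = X ** transpose (mat_power G k)"
  by (induction k) (simp_all add: matrix_transpose_mul matrix_mul_assoc)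

lemma bounded_linear_lyapunov:
  "bounded_linear (\<lambda>X :: real ^ 'n ^ 'n. G ** X ** transpose G)"
  by (intro bounded_linear_compose[OF
        bounded_bilinear.bounded_linear_left[OF bounded_bilinear_matrix_mult]]
      bounded_bilinear.bounded_linear_right[OF bounded_bilinear_matrix_mult])

text \<open>Serves the off-diagonal block: the iterates of the map are right multiplications by
  transposed powers of \<open>G\<close>, so their norms tend to zero with those powers.\<close>

lemma perturbed_right_mult_tendsto_0:
  fixes X :: "nat \<Rightarrow> real ^ 'n ^ 'n"
  assumes G: "mat_power G \<longlonglongrightarrow> 0"
    and bdd: "\<And>n. norm (X n) \<le> B"
    and rec: "(\<lambda>n. X (Suc n) - X n ** transpose G) \<longlonglongrightarrow> 0"
  shows "X \<longlonglongrightarrow> 0"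
proof -
  obtain K where K: "\<And>(Y :: real ^ 'n ^ 'n) (Z :: real ^ 'n ^ 'n). norm (Y ** Z) \<le> norm Y * norm Z * K"
    using bounded_bilinear.bounded[OF bounded_bilinear_matrix_mult] by blast
  show ?thesis
  proof (rule bounded_perturbed_recursion_tendsto_0)
    show "bounded_linear (\<lambda>X :: real ^ 'n ^ 'n. X ** transpose G)"
      by (rule bounded_bilinear.bounded_linear_left[OF bounded_bilinear_matrix_mult])
    show "norm (((\<lambda>X. X ** transpose G) ^^ k) Y) \<le> (norm (transpose (mat_power G k)) * K) * norm Y"
      for k and Y :: "real ^ 'n ^ 'n"
      unfolding right_mult_iterate using K[of Y "transpose (mat_power G k)"] by (simp add: mult_ac)
    have "(\<lambda>k. norm (transpose (mat_power G k)) * K) \<longlonglongrightarrow> norm (transpose (0 :: real ^ 'n ^ 'n)) * K"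
      by (intro tendsto_intros tendsto_transpose G)
    then show "(\<lambda>k. norm (transpose (mat_power G k)) * K) \<longlonglongrightarrow> 0"
      by (simp add: transpose_def vec_eq_iff zero_vec_def[symmetric])
  qed (fact bdd, fact rec)
qed

text \<open>Here each iterate carries a power of \<open>G\<close> on both sides, which accounts for
  the two factors in the bound.\<close>

lemma perturbed_lyapunov_tendsto_0:
  fixes X :: "nat \<Rightarrow> real ^ 'n ^ 'n"
  assumes G: "mat_power G \<longlonglongrightarrow> 0"
    and bdd: "\<And>n. norm (X n) \<le> B"
    and rec: "(\<lambda>n. X (Suc n) - G ** X n ** transpose G) \<longlonglongrightarrow> 0"
  shows "X \<longlonglongrightarrow> 0"
proof -
  obtain K where K0: "K \<ge> 0" and K: "\<And>(Y :: real ^ 'n ^ 'n) (Z :: real ^ 'n ^ 'n). norm (Y ** Z) \<le> norm Y * norm Z * K"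
    using bounded_bilinear.nonneg_bounded[OF bounded_bilinear_matrix_mult] by blast
  let ?P = "mat_power G"
  show ?thesis
  proof (rule bounded_perturbed_recursion_tendsto_0)
    show "bounded_linear (\<lambda>X :: real ^ 'n ^ 'n. G ** X ** transpose G)"
      by (rule bounded_linear_lyapunov)
    show "norm (((\<lambda>X. G ** X ** transpose G) ^^ k) Y)
        \<le> (norm (?P k) * norm (transpose (?P k)) * K * K) * norm Y" for k Y
    proof -
      have "norm (?P k ** Y ** transpose (?P k)) \<le> norm (?P k ** Y) * norm (transpose (?P k)) * K"
        by (rule K)
      also have "\<dots> \<le> (norm (?P k) * norm Y * K) * norm (transpose (?P k)) * K"
        using K0 by (intro mult_right_mono K) auto
      finally show ?thesis unfolding lyapunov_iterate by (simp add: mult_ac)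
    qed
    have "(\<lambda>k. norm (?P k) * norm (transpose (?P k)) * K * K)
        \<longlonglongrightarrow> norm (0 :: real ^ 'n ^ 'n) * norm (transpose (0 :: real ^ 'n ^ 'n)) * K * K"
      by (intro tendsto_intros tendsto_transpose G)
    then show "(\<lambda>k. norm (?P k) * norm (transpose (?P k)) * K * K) \<longlonglongrightarrow> 0" by simp
  qed (fact bdd, fact rec)
qed

text \<open>A solution of the homogeneous equation, taken as a constant sequence, obeys the
  recursion without perturbation and so must vanish. The linear map
  \<open>X - G ** X ** transpose G\<close> is therefore injective, and by finite dimension
  surjective.\<close>

lemma ex1_lyapunov_solution:
  fixes G S :: "real ^ 'n ^ 'n"
  assumes G: "mat_power G \<longlonglongrightarrow> 0"
  shows "\<exists>!X. X = G ** X ** transpose G + S"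
proof -
  let ?T = "\<lambda>X. G ** X ** transpose G"
  have lin: "linear (\<lambda>X. X - ?T X)"
    by (intro linear_compose_sub linear_ident bounded_linear.linear[OF bounded_linear_lyapunov])
  have "X = 0" if "X - ?T X = 0" for X
  proof -
    have "(\<lambda>_ :: nat. X) \<longlonglongrightarrow> 0"
      by (rule perturbed_lyapunov_tendsto_0[OF G order_refl]) (simp only: that tendsto_const)
    then show ?thesis using LIMSEQ_unique tendsto_const by blast
  qed
  then have inj: "inj (\<lambda>X. X - ?T X)" using linear_injective_0[OF lin] by blast
  then have "surj (\<lambda>X. X - ?T X)" using linear_injective_imp_surjective[OF lin] by (simp only: simp_thms)
  then have "S \<in> range (\<lambda>X. X - ?T X)" by (simp only: UNIV_I)
  then obtain X where "S = X - ?T X" by (rule rangeE)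
  then have "X - ?T X = S" by (rule sym)
  moreover have "Y = X" if "Y = ?T Y + S" for Y
  proof -
    have "Y - ?T Y = S" using that by (metis add_diff_cancel_left')
    then show ?thesis using injD[OF inj, of Y X] \<open>X - ?T X = S\<close> by simp
  qed
  moreover have "X = ?T X + S" using \<open>X - ?T X = S\<close> by (metis add.commute diff_add_cancel)
  ultimately show ?thesis by blast
qed

text \<open>Subtracting the fixed point \<open>L\<close> turns the inhomogeneous recursion into a
  homogeneous one with vanishing perturbation.\<close>

lemma perturbed_lyapunov_tendsto:
  fixes X :: "nat \<Rightarrow> real ^ 'n ^ 'n"
  assumes G: "mat_power G \<longlonglongrightarrow> 0"
    and bdd: "\<And>n. norm (X n) \<le> B"
    and rec: "(\<lambda>n. X (Suc n) - G ** X n ** transpose G) \<longlonglongrightarrow> S"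
    and L: "L = G ** L ** transpose G + S"
  shows "X \<longlonglongrightarrow> L"
proof -
  have "(\<lambda>n. X n - L) \<longlonglongrightarrow> 0"
  proof (rule perturbed_lyapunov_tendsto_0[OF G])
    show "norm (X n - L) \<le> B + norm L" for n
      using norm_triangle_ineq4[of "X n" L] bdd[of n] by linarith
    have "(\<lambda>n. X (Suc n) - G ** X n ** transpose G - S) \<longlonglongrightarrow> S - S"
      by (intro tendsto_intros rec)
    moreover have "X (Suc n) - L - G ** (X n - L) ** transpose G
        = X (Suc n) - G ** X n ** transpose G - S" for n
    proof -
      have "G ** (X n - L) ** transpose G = G ** X n ** transpose G - G ** L ** transpose G"
        by (rule linear_diff[OF bounded_linear.linear[OF bounded_linear_lyapunov]])
      moreover have "S = L - G ** L ** transpose G" by (subst (1) L) simp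
      ultimately show ?thesis by simp
    qed
    ultimately show "(\<lambda>n. X (Suc n) - L - G ** (X n - L) ** transpose G) \<longlonglongrightarrow> 0"
      by (simp only: diff_self)
  qed
  then show ?thesis by (simp add: LIM_zero_iff)
qed

text \<open>The Cesaro argument: after removal of the linear drift
  \<open>real n *\<^sub>R e\<close>, the increments are eventually shorter than
  \<open>r / 2\<close>, so the remaining sequence grows with at most that slope.\<close>

lemma increments_tendsto_imp_average_tendsto:
  fixes a :: "nat \<Rightarrow> 'a::real_normed_vector"
  assumes "(\<lambda>n. a (Suc n) - a n) \<longlonglongrightarrow> e"
  shows "(\<lambda>n. (1 / real n) *\<^sub>R a n) \<longlonglongrightarrow> e"
proof -
  define b where "b n = a n - real n *\<^sub>R e" for n
  have "(\<lambda>n. (a (Suc n) - a n) - e) \<longlonglongrightarrow> e - e" by (intro tendsto_intros assms)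
  then have b: "(\<lambda>n. b (Suc n) - b n) \<longlonglongrightarrow> 0"
    by (simp add: b_def algebra_simps)
  have "(\<lambda>n. (1 / real n) *\<^sub>R b n) \<longlonglongrightarrow> 0"
  proof (rule metric_LIMSEQ_I)
    fix r :: real assume "r > 0"
    then obtain N where N: "\<And>n. n \<ge> N \<Longrightarrow> norm (b (Suc n) - b n) < r / 2"
      using LIMSEQ_D[OF b, of "r / 2"] by auto
    have bnd: "norm (b (N + k)) \<le> norm (b N) + r / 2 * real k" for k
    proof (induction k)
      case (Suc k)
      then show ?case
        using N[of "N + k"] norm_triangle_sub[of "b (Suc (N + k))" "b (N + k)"]
        by (simp add: distrib_left)
    qed simp
    \<comment> \<open>Beyond this index the starting value \<open>b N\<close>, divided by
      \<open>n\<close>, contributes less than the other \<open>r / 2\<close>.\<close>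
    obtain K where K: "real K > 2 * norm (b N) / r" using reals_Archimedean2 by blast
    have "dist ((1 / real n) *\<^sub>R b n) 0 < r" if n: "n \<ge> N + K + 1" for n
    proof -
      have "2 * norm (b N) < r * real n" 
      proof -
        have "2 * norm (b N) < r * real K" using K \<open>r > 0\<close>
          by (simp add: pos_divide_less_eq mult.commute)
        also have "\<dots> \<le> r * real n" using n \<open>r > 0\<close> by (intro mult_left_mono) auto
        finally show ?thesis .
      qed
      moreover have "norm (b n) \<le> norm (b N) + r / 2 * real n"
      proof -
        have "norm (b n) \<le> norm (b N) + r / 2 * real (n - N)" using bnd[of "n - N"] n by simp
        also have "\<dots> \<le> norm (b N) + r / 2 * real n"
          using \<open>r > 0\<close> by (intro add_left_mono mult_left_mono) auto
        finally show ?thesis .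
      qed
      ultimately have "norm (b n) < r * real n" by linarith
      then show ?thesis using n by (simp add: pos_divide_less_eq mult.commute)
    qed
    then show "\<exists>no. \<forall>n\<ge>no. dist ((1 / real n) *\<^sub>R b n) 0 < r" by blast
  qed
  then have lim: "(\<lambda>n. (1 / real n) *\<^sub>R b n + e) \<longlonglongrightarrow> e"
    using tendsto_add[of _ 0 _ "\<lambda>_. e" e] by simp
  have "\<forall>\<^sub>F n in sequentially. (1 / real n) *\<^sub>R b n + e = (1 / real n) *\<^sub>R a n"
    using eventually_gt_at_top[of 0] by eventually_elim (simp add: b_def scaleR_diff_right)
  then show ?thesis by (rule Lim_transform_eventually[OF lim])
qed

subsection \<open>Second moments of essentially bounded random vectors\<close>

text \<open>Row \<open>i\<close> of the outer product is a multiple of \<open>y\<close>, so the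
  Euclidean norm of the matrix factors.\<close>

lemma norm_outer_le: "norm (outer x y) \<le> norm x * norm y"
proof -
  have "outer x y $ i = (x $ i) *\<^sub>R y" for i by (simp add: outer_def vec_eq_iff)
  then have "norm (outer x y) = L2_set (\<lambda>i. \<bar>x $ i\<bar> * norm y) UNIV"
    by (simp add: norm_vec_def[of "outer x y"])
  also have "\<dots> = norm x * norm y"
    by (simp add: norm_vec_def[of x] L2_set_left_distrib)
  finally show ?thesis by simp
qed

lemma outer_matrix_left: "outer (B *v x) y = B ** outer x y"
  by (simp add: outer_def vec_eq_iff matrix_vector_mult_def matrix_matrix_mult_def
      sum_distrib_right mult.assoc)

lemma transpose_outer: "transpose (outer x y) = outer y x"
  by (simp add: outer_def vec_eq_iff transpose_def)

text \<open>\<open>M\<close> supplies the null sets and \<open>F\<close> the measurability, so one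
  predicate expresses both adaptedness and integrability of all products. The bound belongs to a
  single variable and need not be uniform along a process.\<close>

definition ess_bounded :: "'w measure \<Rightarrow> 'w measure \<Rightarrow> ('w \<Rightarrow> 'e::euclidean_space) \<Rightarrow> bool"
  where "ess_bounded M F X \<longleftrightarrow> X \<in> borel_measurable F \<and> (\<exists>C. AE \<omega> in M. norm (X \<omega>) \<le> C)"

lemma ess_boundedI:
  assumes "X \<in> borel_measurable F" "AE \<omega> in M. norm (X \<omega>) \<le> C"
  shows "ess_bounded M F X"
  using assms unfolding ess_bounded_def by blast

lemma ess_bounded_measurable: "ess_bounded M F X \<Longrightarrow> X \<in> borel_measurable F"
  by (simp add: ess_bounded_def)

lemma ess_bounded_subalgebra:
  assumes "ess_bounded M F X" "subalgebra H F"
  shows "ess_bounded M H X"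
  using assms measurable_from_subalg unfolding ess_bounded_def by blast

text \<open>The recursion is known only on \<open>space M\<close>, so equality of functions is
  available only there.\<close>

lemma ess_bounded_cong:
  assumes "ess_bounded M F X" "space F = space M" "\<And>\<omega>. \<omega> \<in> space M \<Longrightarrow> X \<omega> = Y \<omega>"
  shows "ess_bounded M F Y"
proof -
  obtain C where C: "AE \<omega> in M. norm (X \<omega>) \<le> C" using assms(1) by (auto simp: ess_bounded_def)
  have "AE \<omega> in M. norm (Y \<omega>) \<le> C"
    using C AE_space by eventually_elim (simp add: assms(3))
  moreover have "Y \<in> borel_measurable F"
    using ess_bounded_measurable[OF assms(1)] assms(2,3) measurable_cong[of F X Y borel] by simp
  ultimately show ?thesis by (intro ess_boundedI)
qed

lemma ess_bounded_const [simp]: "ess_bounded M F (\<lambda>\<omega>. c)"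
  by (rule ess_boundedI[where C = "norm c"]) auto

lemma ess_bounded_bilinear:
  fixes h :: "'a::euclidean_space \<Rightarrow> 'b::euclidean_space \<Rightarrow> 'c::euclidean_space"
  assumes h: "bounded_bilinear h" and X: "ess_bounded M F X" and Y: "ess_bounded M F Y"
  shows "ess_bounded M F (\<lambda>\<omega>. h (X \<omega>) (Y \<omega>))"
proof -
  obtain K where K: "K \<ge> 0" "\<And>x y. norm (h x y) \<le> norm x * norm y * K"
    using bounded_bilinear.nonneg_bounded[OF h] by blast
  obtain C D where CD: "AE \<omega> in M. norm (X \<omega>) \<le> C" "AE \<omega> in M. norm (Y \<omega>) \<le> D"
    using X Y unfolding ess_bounded_def by blast
  have "(\<lambda>\<omega>. h (X \<omega>) (Y \<omega>)) \<in> borel_measurable F"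
    by (rule borel_measurable_continuous_Pair[OF X[THEN ess_bounded_measurable]
          Y[THEN ess_bounded_measurable]])
      (intro bounded_bilinear.continuous_on[OF h] continuous_intros)
  moreover have "AE \<omega> in M. norm (h (X \<omega>) (Y \<omega>)) \<le> C * D * K"
    using CD
  proof eventually_elim
    case (elim \<omega>)
    have "norm (X \<omega>) * norm (Y \<omega>) \<le> C * D"
      using elim by (intro mult_mono) (auto intro: order_trans[OF norm_ge_zero])
    then show ?case using K(2)[of "X \<omega>" "Y \<omega>"] mult_right_mono[OF _ K(1)] by fastforce
  qed
  ultimately show ?thesis by (rule ess_boundedI)
qed

lemma ess_bounded_linear:
  fixes h :: "'a::euclidean_space \<Rightarrow> 'b::euclidean_space"
  assumes h: "bounded_linear h" and X: "ess_bounded M F X"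
  shows "ess_bounded M F (\<lambda>\<omega>. h (X \<omega>))"
proof -
  \<comment> \<open>The linear case is the bilinear one with the constant \<open>1\<close> as second
    argument.\<close>
  have "bounded_bilinear (\<lambda>x (r::real). r *\<^sub>R h x)"
    using bounded_bilinear.comp1[OF bounded_bilinear.flip[OF bounded_bilinear_scaleR] h] .
  from ess_bounded_bilinear[OF this X ess_bounded_const[of M F 1]] show ?thesis by simp
qed

lemma ess_bounded_add:
  assumes "ess_bounded M F X" "ess_bounded M F Y"
  shows "ess_bounded M F (\<lambda>\<omega>. X \<omega> + Y \<omega>)"
proof -
  obtain C D where CD: "AE \<omega> in M. norm (X \<omega>) \<le> C" "AE \<omega> in M. norm (Y \<omega>) \<le> D"
    using assms unfolding ess_bounded_def by blast
  then have "AE \<omega> in M. norm (X \<omega> + Y \<omega>) \<le> C + D"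
    by eventually_elim (metis add_mono norm_triangle_ineq order_trans)
  then show ?thesis
    using assms[THEN ess_bounded_measurable] by (intro ess_boundedI borel_measurable_add)
qed

lemmas ess_bounded_scaleR = ess_bounded_linear[OF bounded_linear_scaleR_right]
lemmas ess_bounded_matrix = ess_bounded_linear[OF matrix_vector_mul_bounded_linear]

lemma ess_bounded_diff:
  assumes "ess_bounded M F X" "ess_bounded M F Y"
  shows "ess_bounded M F (\<lambda>\<omega>. X \<omega> - Y \<omega>)"
  using ess_bounded_add[OF assms(1) ess_bounded_scaleR[OF assms(2), of "-1"]] by simp

lemmas ess_bounded_intros = ess_bounded_add ess_bounded_diff ess_bounded_scaleR ess_bounded_matrix
  ess_bounded_const

section \<open>Calculus of cross moments and the mean square norm\<close>

definition cross_moment :: "'w measure \<Rightarrow> ('w \<Rightarrow> real ^ 'm) \<Rightarrow> ('w \<Rightarrow> real ^ 'n) \<Rightarrow> real ^ 'n ^ 'm"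
  where "cross_moment M X Y = (\<integral>\<omega>. outer (X \<omega>) (Y \<omega>) \<partial>M)"

text \<open>A non-integrable function has Bochner integral zero, so this behaves as a norm only for
  square integrable variables; the inequalities that follow therefore assume
  \<open>ess_bounded\<close>.\<close>

definition l2_norm :: "'w measure \<Rightarrow> ('w \<Rightarrow> 'e::euclidean_space) \<Rightarrow> real"
  where "l2_norm M X = sqrt (\<integral>\<omega>. (norm (X \<omega>))\<^sup>2 \<partial>M)"

lemma l2_norm_nonneg [simp]: "l2_norm M X \<ge> 0"
  by (simp add: l2_norm_def)

lemma l2_norm_square: "(l2_norm M X)\<^sup>2 = (\<integral>\<omega>. (norm (X \<omega>))\<^sup>2 \<partial>M)"
  by (simp add: l2_norm_def)

lemma cross_moment_cong:
  assumes "\<And>\<omega>. \<omega> \<in> space M \<Longrightarrow> X \<omega> = X' \<omega>" "\<And>\<omega>. \<omega> \<in> space M \<Longrightarrow> Y \<omega> = Y' \<omega>"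
  shows "cross_moment M X Y = cross_moment M X' Y'"
  unfolding cross_moment_def using assms by (intro Bochner_Integration.integral_cong) auto

context prob_space
begin

lemma ess_bounded_integrable:
  fixes X :: "'a \<Rightarrow> 'e::euclidean_space"
  assumes "ess_bounded M M X"
  shows "integrable M X"
  using assms unfolding ess_bounded_def by (auto intro: integrable_const_bound)

lemma integrable_outer:
  assumes "ess_bounded M M X" "ess_bounded M M Y"
  shows "integrable M (\<lambda>\<omega>. outer (X \<omega>) (Y \<omega>))"
  by (rule ess_bounded_integrable[OF ess_bounded_bilinear[OF bounded_bilinear_outer assms]])

lemma integrable_norm_mult:
  fixes X :: "'a \<Rightarrow> 'e::euclidean_space" and Y :: "'a \<Rightarrow> 'f::euclidean_space"
  assumes X: "ess_bounded M M X" and Y: "ess_bounded M M Y"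
  shows "integrable M (\<lambda>\<omega>. norm (X \<omega>) * norm (Y \<omega>))"
proof -
  have *: "ess_bounded M M (\<lambda>\<omega>. norm (Z \<omega>))" if "ess_bounded M M Z" for Z :: "'a \<Rightarrow> 'g::euclidean_space"
    using that unfolding ess_bounded_def by auto
  show ?thesis
    by (rule ess_bounded_integrable[OF ess_bounded_bilinear[OF bounded_bilinear_mult * *, OF X Y]])
qed

lemma integrable_norm_square:
  fixes X :: "'a \<Rightarrow> 'e::euclidean_space"
  assumes X: "ess_bounded M M X"
  shows "integrable M (\<lambda>\<omega>. (norm (X \<omega>))\<^sup>2)"
  using integrable_norm_mult[OF X X] by (simp add: power2_eq_square)

text \<open>Cauchy-Schwarz by the discriminant: the mean square of
  \<open>norm (X \<omega>) - t * norm (Y \<omega>)\<close> is a nonnegative polynomial in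
  \<open>t\<close>.\<close>

lemma integral_norm_mult_le:
  fixes X :: "'a \<Rightarrow> 'e::euclidean_space" and Y :: "'a \<Rightarrow> 'f::euclidean_space"
  assumes X: "ess_bounded M M X" and Y: "ess_bounded M M Y"
  shows "(\<integral>\<omega>. norm (X \<omega>) * norm (Y \<omega>) \<partial>M) \<le> l2_norm M X * l2_norm M Y"
proof -
  define a b c where "a = (\<integral>\<omega>. (norm (X \<omega>))\<^sup>2 \<partial>M)" and "b = (\<integral>\<omega>. norm (X \<omega>) * norm (Y \<omega>) \<partial>M)"
    and "c = (\<integral>\<omega>. (norm (Y \<omega>))\<^sup>2 \<partial>M)"
  note [simp] = integrable_norm_mult[OF X Y] integrable_norm_square[OF X] integrable_norm_square[OF Y]
  have "a \<ge> 0" "b \<ge> 0" "c \<ge> 0" by (simp_all add: a_def b_def c_def)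
  have quad: "0 \<le> a - 2 * t * b + t\<^sup>2 * c" for t
  proof -
    have "0 \<le> (\<integral>\<omega>. (norm (X \<omega>) - t * norm (Y \<omega>))\<^sup>2 \<partial>M)" by simp
    also have "\<dots> = (\<integral>\<omega>. (norm (X \<omega>))\<^sup>2 - 2 * t * (norm (X \<omega>) * norm (Y \<omega>)) + t\<^sup>2 * (norm (Y \<omega>))\<^sup>2 \<partial>M)"
      by (simp add: power2_eq_square algebra_simps)
    also have "\<dots> = a - 2 * t * b + t\<^sup>2 * c" by (simp add: a_def b_def c_def)
    finally show ?thesis .
  qed
  have "b\<^sup>2 \<le> a * c"
  proof (cases "c = 0")
    case True
    \<comment> \<open>With \<open>c = 0\<close> the polynomial is affine in \<open>t\<close>; if
      \<open>b\<close> were nonzero, the chosen \<open>t\<close> would give it the value -1.\<close>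
    have "b = 0"
      using quad[of "(a + 1) / (2 * b)"] \<open>a \<ge> 0\<close> True by (cases "b = 0") (auto simp: field_simps)
    then show ?thesis using \<open>a \<ge> 0\<close> True by simp
  next
    case False
    then have "c > 0" using \<open>c \<ge> 0\<close> by simp
    \<comment> \<open>The point \<open>b / c\<close> is the minimiser of the polynomial.\<close>
    have "0 \<le> a - b\<^sup>2 / c" using quad[of "b / c"] \<open>c > 0\<close> by (simp add: field_simps power2_eq_square)
    then show ?thesis using \<open>c > 0\<close> by (simp add: pos_divide_le_eq)
  qed
  then show ?thesis
    unfolding l2_norm_def a_def[symmetric] b_def[symmetric] c_def[symmetric]
      real_sqrt_mult[symmetric] by (rule real_le_rsqrt)
qed

lemma norm_cross_moment_le:
  assumes X: "ess_bounded M M X" and Y: "ess_bounded M M Y"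
  shows "norm (cross_moment M X Y) \<le> l2_norm M X * l2_norm M Y"
proof -
  have "norm (cross_moment M X Y) \<le> (\<integral>\<omega>. norm (outer (X \<omega>) (Y \<omega>)) \<partial>M)"
    unfolding cross_moment_def by (rule integral_norm_bound)
  also have "\<dots> \<le> (\<integral>\<omega>. norm (X \<omega>) * norm (Y \<omega>) \<partial>M)"
    using integrable_outer[OF X Y] integrable_norm_mult[OF X Y]
    by (intro integral_mono integrable_norm norm_outer_le)
  also have "\<dots> \<le> l2_norm M X * l2_norm M Y" by (rule integral_norm_mult_le[OF X Y])
  finally show ?thesis .
qed

lemma l2_norm_mono:
  fixes X :: "'a \<Rightarrow> 'e::euclidean_space" and Y :: "'a \<Rightarrow> 'f::euclidean_space"
  assumes X: "ess_bounded M M X" and Y: "ess_bounded M M Y"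
    and le: "AE \<omega> in M. norm (X \<omega>) \<le> C * norm (Y \<omega>)" and "C \<ge> 0"
  shows "l2_norm M X \<le> C * l2_norm M Y"
proof -
  have "(\<integral>\<omega>. (norm (X \<omega>))\<^sup>2 \<partial>M) \<le> (\<integral>\<omega>. C\<^sup>2 * (norm (Y \<omega>))\<^sup>2 \<partial>M)"
  proof (rule integral_mono_AE)
    show "AE \<omega> in M. (norm (X \<omega>))\<^sup>2 \<le> C\<^sup>2 * (norm (Y \<omega>))\<^sup>2"
      using le by eventually_elim (metis norm_ge_zero power_mono power_mult_distrib)
  qed (use integrable_norm_square[OF X] integrable_norm_square[OF Y] in auto)
  also have "\<dots> = (C * l2_norm M Y)\<^sup>2"
    by (simp add: l2_norm_square power_mult_distrib)
  finally show ?thesis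
    using \<open>C \<ge> 0\<close> by (intro power2_le_imp_le[of "l2_norm M X"]) (simp_all add: l2_norm_square)
qed

lemma l2_norm_add:
  fixes X Y :: "'a \<Rightarrow> 'e::euclidean_space"
  assumes X: "ess_bounded M M X" and Y: "ess_bounded M M Y"
  shows "l2_norm M (\<lambda>\<omega>. X \<omega> + Y \<omega>) \<le> l2_norm M X + l2_norm M Y"
proof (rule power2_le_imp_le)
  note [simp] = integrable_norm_mult[OF X Y] integrable_norm_square[OF X] integrable_norm_square[OF Y]
  have "(l2_norm M (\<lambda>\<omega>. X \<omega> + Y \<omega>))\<^sup>2
      \<le> (\<integral>\<omega>. (norm (X \<omega>))\<^sup>2 + 2 * (norm (X \<omega>) * norm (Y \<omega>)) + (norm (Y \<omega>))\<^sup>2 \<partial>M)"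
    unfolding l2_norm_square
  proof (rule integral_mono)
    fix \<omega>
    have "(norm (X \<omega> + Y \<omega>))\<^sup>2 \<le> (norm (X \<omega>) + norm (Y \<omega>))\<^sup>2"
      by (intro power_mono norm_triangle_ineq) simp
    then show "(norm (X \<omega> + Y \<omega>))\<^sup>2
        \<le> (norm (X \<omega>))\<^sup>2 + 2 * (norm (X \<omega>) * norm (Y \<omega>)) + (norm (Y \<omega>))\<^sup>2"
      by (simp add: power2_sum)
  qed (simp_all add: integrable_norm_square[OF ess_bounded_add[OF X Y]])
  also have "\<dots> = (l2_norm M X)\<^sup>2 + 2 * (\<integral>\<omega>. norm (X \<omega>) * norm (Y \<omega>) \<partial>M) + (l2_norm M Y)\<^sup>2"
    by (simp add: l2_norm_square)
  also have "\<dots> \<le> (l2_norm M X + l2_norm M Y)\<^sup>2"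
    using integral_norm_mult_le[OF X Y] by (simp add: power2_sum)
  finally show "(l2_norm M (\<lambda>\<omega>. X \<omega> + Y \<omega>))\<^sup>2 \<le> (l2_norm M X + l2_norm M Y)\<^sup>2" .
qed simp

lemma l2_norm_scaleR:
  fixes X :: "'a \<Rightarrow> 'e::euclidean_space"
  shows "l2_norm M (\<lambda>\<omega>. c *\<^sub>R X \<omega>) = \<bar>c\<bar> * l2_norm M X"
  by (simp add: l2_norm_def power_mult_distrib real_sqrt_mult)

lemma l2_norm_matrix:
  fixes B :: "real ^ 'n ^ 'm"
  assumes X: "ess_bounded M M X"
  shows "l2_norm M (\<lambda>\<omega>. B *v X \<omega>) \<le> onorm ((*v) B) * l2_norm M X"
  by (rule l2_norm_mono[OF ess_bounded_matrix[OF X] X])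
    (auto intro!: onorm onorm_pos_le)

lemma cross_moment_add_left:
  assumes "ess_bounded M M X" "ess_bounded M M X'" "ess_bounded M M Y"
  shows "cross_moment M (\<lambda>\<omega>. X \<omega> + X' \<omega>) Y = cross_moment M X Y + cross_moment M X' Y"
  unfolding cross_moment_def bounded_bilinear.add_left[OF bounded_bilinear_outer]
  by (intro Bochner_Integration.integral_add integrable_outer assms)

lemma cross_moment_add_right:
  assumes "ess_bounded M M X" "ess_bounded M M Y" "ess_bounded M M Y'"
  shows "cross_moment M X (\<lambda>\<omega>. Y \<omega> + Y' \<omega>) = cross_moment M X Y + cross_moment M X Y'"
  unfolding cross_moment_def bounded_bilinear.add_right[OF bounded_bilinear_outer]
  by (intro Bochner_Integration.integral_add integrable_outer assms)

lemma cross_moment_add_self: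
  assumes X: "ess_bounded M M X" and Y: "ess_bounded M M Y"
  shows "cross_moment M (\<lambda>\<omega>. X \<omega> + Y \<omega>) (\<lambda>\<omega>. X \<omega> + Y \<omega>)
    = cross_moment M X X + (cross_moment M X Y + cross_moment M Y X + cross_moment M Y Y)"
  using X Y by (simp add: cross_moment_add_left cross_moment_add_right ess_bounded_add)

lemma cross_moment_scaleR_left:
  "cross_moment M (\<lambda>\<omega>. c *\<^sub>R X \<omega>) Y = c *\<^sub>R cross_moment M X Y"
  unfolding cross_moment_def bounded_bilinear.scaleR_left[OF bounded_bilinear_outer] by simp

lemma cross_moment_scaleR_right:
  "cross_moment M X (\<lambda>\<omega>. c *\<^sub>R Y \<omega>) = c *\<^sub>R cross_moment M X Y"
  unfolding cross_moment_def bounded_bilinear.scaleR_right[OF bounded_bilinear_outer] by simp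

lemma transpose_cross_moment:
  assumes "ess_bounded M M X" "ess_bounded M M Y"
  shows "transpose (cross_moment M X Y) = cross_moment M Y X"
  unfolding cross_moment_def
  by (simp add: integral_bounded_linear[OF bounded_linear_transpose integrable_outer[OF assms], symmetric]
      transpose_outer)

lemma cross_moment_matrix_left:
  assumes "ess_bounded M M X" "ess_bounded M M Y"
  shows "cross_moment M (\<lambda>\<omega>. B *v X \<omega>) Y = B ** cross_moment M X Y"
  unfolding cross_moment_def outer_matrix_left
  by (rule integral_bounded_linear[OF
        bounded_bilinear.bounded_linear_right[OF bounded_bilinear_matrix_mult] integrable_outer[OF assms]])

lemma cross_moment_matrix_right:
  assumes "ess_bounded M M X" "ess_bounded M M Y"
  shows "cross_moment M X (\<lambda>\<omega>. B *v Y \<omega>) = cross_moment M X Y ** transpose B"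
proof -
  have "cross_moment M X (\<lambda>\<omega>. B *v Y \<omega>) = transpose (B ** cross_moment M Y X)"
    using assms by (simp only: transpose_cross_moment ess_bounded_matrix flip: cross_moment_matrix_left)
  then show ?thesis using assms by (simp add: matrix_transpose_mul transpose_cross_moment)
qed

lemma cross_moment_entry:
  assumes "ess_bounded M M X" "ess_bounded M M Y"
  shows "cross_moment M X Y $ i $ j = (\<integral>\<omega>. X \<omega> $ i * Y \<omega> $ j \<partial>M)"
proof -
  have "bounded_linear (\<lambda>x :: real ^ 'c ^ 'b. x $ i $ j)"
    using bounded_linear_compose[OF bounded_linear_vec_nth bounded_linear_vec_nth] .
  from integral_bounded_linear[OF this integrable_outer[OF assms]]
  show ?thesis by (simp add: cross_moment_def outer_def)
qed

text \<open>The quadratic form at \<open>u\<close> is linear in the matrix, so it passes under the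
  integral, where it becomes the square of \<open>u \<bullet> X \<omega>\<close>.\<close>

lemma pos_semidef_cross_moment:
  fixes X :: "'a \<Rightarrow> real ^ 'b"
  assumes X: "ess_bounded M M X"
  shows "pos_semidef (cross_moment M X X)"
  unfolding pos_semidef_def
proof (intro conjI allI)
  show "transpose (cross_moment M X X) = cross_moment M X X" by (rule transpose_cross_moment[OF X X])
  fix u :: "real ^ 'b"
  let ?h = "\<lambda>S :: real ^ 'b ^ 'b. u \<bullet> (S *v u)"
  have "bounded_linear ?h"
    by (rule bounded_linear_compose[OF bounded_linear_inner_right
          bounded_bilinear.bounded_linear_left[OF bounded_bilinear_matrix_vector_mult]])
  from integral_bounded_linear[OF this integrable_outer[OF X X]]
  have "?h (cross_moment M X X) = (\<integral>\<omega>. ?h (outer (X \<omega>) (X \<omega>)) \<partial>M)"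
    by (simp add: cross_moment_def)
  moreover have "?h (outer x x) = (u \<bullet> x)\<^sup>2" for x :: "real ^ 'b"
    by (simp add: inner_vec_def matrix_vector_mult_def outer_def power2_eq_square sum_distrib_left
        sum_distrib_right sum_product mult_ac)
  ultimately show "0 \<le> ?h (cross_moment M X X)" by simp
qed

lemma cross_moment_tendsto_0:
  assumes X: "\<And>n. ess_bounded M M (X n)" and Y: "\<And>n. ess_bounded M M (Y n)"
    and bdd: "\<And>n. l2_norm M (X n) \<le> K" and lim: "(\<lambda>n. l2_norm M (Y n)) \<longlonglongrightarrow> 0"
  shows "(\<lambda>n. cross_moment M (X n) (Y n)) \<longlonglongrightarrow> 0" "(\<lambda>n. cross_moment M (Y n) (X n)) \<longlonglongrightarrow> 0"
proof -
  have K: "(\<lambda>n. K * l2_norm M (Y n)) \<longlonglongrightarrow> 0" using tendsto_mult[OF tendsto_const lim] by simp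
  have le: "l2_norm M (X n) * l2_norm M (Y n) \<le> K * l2_norm M (Y n)" for n
    by (intro mult_right_mono bdd) simp
  show "(\<lambda>n. cross_moment M (X n) (Y n)) \<longlonglongrightarrow> 0"
    by (rule Lim_null_comparison[OF always_eventually K])
      (use le norm_cross_moment_le[OF X Y] order_trans in blast)
  show "(\<lambda>n. cross_moment M (Y n) (X n)) \<longlonglongrightarrow> 0"
    by (rule Lim_null_comparison[OF always_eventually K])
      (use le norm_cross_moment_le[OF Y X] order_trans in \<open>metis mult.commute\<close>)
qed

text \<open>Allows terms that are small in mean square to be dropped from a covariance: each of the
  three additional moments contains such a factor and another one of bounded norm.\<close>

lemma cross_moment_perturbation_tendsto_0:
  assumes X: "\<And>n. ess_bounded M M (X n)" and Y: "\<And>n. ess_bounded M M (Y n)"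
    and bdd: "\<And>n. l2_norm M (X n) \<le> K" and lim: "(\<lambda>n. l2_norm M (Y n)) \<longlonglongrightarrow> 0"
  shows "(\<lambda>n. cross_moment M (\<lambda>\<omega>. X n \<omega> + Y n \<omega>) (\<lambda>\<omega>. X n \<omega> + Y n \<omega>)
    - cross_moment M (X n) (X n)) \<longlonglongrightarrow> 0"
proof -
  obtain K' where K': "\<And>n. l2_norm M (Y n) \<le> K'"
    using convergent_imp_Bseq[OF convergentI[OF lim]] by (metis BseqE abs_le_D1 real_norm_def)
  have "(\<lambda>n. cross_moment M (X n) (Y n) + cross_moment M (Y n) (X n) + cross_moment M (Y n) (Y n))
      \<longlonglongrightarrow> 0 + 0 + 0"
    by (intro tendsto_add cross_moment_tendsto_0[OF X Y bdd lim] cross_moment_tendsto_0[OF Y Y K' lim])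
  then show ?thesis by (simp add: cross_moment_add_self[OF X Y])
qed

lemma l2_norm_tendsto_0I:
  assumes "\<forall>\<^sub>F n in sequentially. l2_norm M (X n) \<le> g n" "g \<longlonglongrightarrow> 0"
  shows "(\<lambda>n. l2_norm M (X n)) \<longlonglongrightarrow> 0"
  by (rule Lim_null_comparison[of _ g]) (use assms in auto)

lemma l2_norm_add_tendsto_0:
  fixes X Y :: "nat \<Rightarrow> 'a \<Rightarrow> 'e::euclidean_space"
  assumes "\<And>n. ess_bounded M M (X n)" "\<And>n. ess_bounded M M (Y n)"
    and "(\<lambda>n. l2_norm M (X n)) \<longlonglongrightarrow> 0" "(\<lambda>n. l2_norm M (Y n)) \<longlonglongrightarrow> 0"
  shows "(\<lambda>n. l2_norm M (\<lambda>\<omega>. X n \<omega> + Y n \<omega>)) \<longlonglongrightarrow> 0"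
  using tendsto_add[OF assms(3,4)] l2_norm_add[OF assms(1,2)]
  by (intro l2_norm_tendsto_0I[of _ "\<lambda>n. l2_norm M (X n) + l2_norm M (Y n)"]) auto

lemma l2_norm_matrix_tendsto_0:
  fixes B :: "real ^ 'n ^ 'm"
  assumes "\<And>n. ess_bounded M M (X n)" "(\<lambda>n. l2_norm M (X n)) \<longlonglongrightarrow> 0"
  shows "(\<lambda>n. l2_norm M (\<lambda>\<omega>. B *v X n \<omega>)) \<longlonglongrightarrow> 0"
  using tendsto_mult_right_zero[OF assms(2)] l2_norm_matrix[OF assms(1), where B = B]
  by (intro l2_norm_tendsto_0I[of _ "\<lambda>n. onorm ((*v) B) * l2_norm M (X n)"]) auto

lemma l2_norm_scaleR_tendsto_0:
  fixes X :: "nat \<Rightarrow> 'a \<Rightarrow> 'e::euclidean_space"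
  assumes "c \<longlonglongrightarrow> 0" "\<And>n. l2_norm M (X n) \<le> K"
  shows "(\<lambda>n. l2_norm M (\<lambda>\<omega>. c n *\<^sub>R X n \<omega>)) \<longlonglongrightarrow> 0"
proof (rule l2_norm_tendsto_0I)
  show "\<forall>\<^sub>F n in sequentially. l2_norm M (\<lambda>\<omega>. c n *\<^sub>R X n \<omega>) \<le> \<bar>c n\<bar> * K"
    using assms(2) by (auto simp: l2_norm_scaleR intro!: mult_left_mono always_eventually)
  show "(\<lambda>n. \<bar>c n\<bar> * K) \<longlonglongrightarrow> 0"
    using tendsto_mult_left_zero[OF tendsto_rabs_zero[OF assms(1)]] .
qed

lemma l2_norm_matrix_le:
  fixes B :: "real ^ 'n ^ 'm"
  assumes "ess_bounded M M X" "l2_norm M X \<le> K"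
  shows "l2_norm M (\<lambda>\<omega>. B *v X \<omega>) \<le> onorm ((*v) B) * K"
  using l2_norm_matrix[OF assms(1), of B] assms(2)
  by (meson mult_left_mono onorm_pos_le matrix_vector_mul_bounded_linear order_trans)

lemma l2_norm_const_bound:
  fixes X :: "'a \<Rightarrow> 'e::euclidean_space"
  assumes X: "ess_bounded M M X" and le: "AE \<omega> in M. norm (X \<omega>) \<le> C" and C: "C \<ge> 0"
  shows "l2_norm M X \<le> C"
proof -
  have "l2_norm M X \<le> C * l2_norm M (\<lambda>\<omega>. 1 :: real)"
    using le by (intro l2_norm_mono[OF X ess_bounded_const _ C]) auto
  then show ?thesis by (simp add: l2_norm_def prob_space)
qed

text \<open>The factor \<open>f\<close> is measurable for \<open>F\<close> and can be pulled out of
  the conditional expectation, which is zero.\<close>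

lemma martingale_difference_orthogonal:
  fixes X :: "'a \<Rightarrow> 'e::euclidean_space" and f :: "'a \<Rightarrow> real"
  assumes sub: "subalgebra M F" and f: "ess_bounded M F f" and X: "ess_bounded M M X"
    and ce: "cond_exp_eq M F X (\<lambda>\<omega>. 0)" and u: "u \<in> Basis"
  shows "(\<integral>\<omega>. f \<omega> * (X \<omega> \<bullet> u) \<partial>M) = 0"
proof -
  interpret finite_measure_subalgebra M F by unfold_locales (rule sub)
  have Xu: "ess_bounded M M (\<lambda>\<omega>. X \<omega> \<bullet> u)" by (rule ess_bounded_linear[OF bounded_linear_inner_left X])
  have "integrable M (\<lambda>\<omega>. f \<omega> * (X \<omega> \<bullet> u))"
    by (rule ess_bounded_integrable[OF ess_bounded_bilinear[OF bounded_bilinear_mult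
            ess_bounded_subalgebra[OF f sub] Xu]])
  note rce = real_cond_exp_intg(2)[OF this ess_bounded_measurable[OF f] ess_bounded_measurable[OF Xu]]
  have "AE \<omega> in M. f \<omega> * real_cond_exp M F (\<lambda>\<omega>. X \<omega> \<bullet> u) \<omega> = 0"
    using ce u unfolding cond_exp_eq_def by (auto elim: eventually_mono)
  from integral_eq_zero_AE[OF this] show ?thesis using rce by simp
qed

end

section \<open>Natural filtrations, and limits of positive semidefinite and block matrices\<close>

lemma space_natural_filtration [simp]: "space (natural_filtration M X n) = space M"
  by (auto simp: natural_filtration_def space_measure_of_conv)

lemma subalgebra_natural_filtration:
  assumes "\<And>k. 1 \<le> k \<Longrightarrow> X k \<in> borel_measurable M"
  shows "subalgebra M (natural_filtration M X n)"
proof -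
  have "{X k -` S \<inter> space M |k S. 1 \<le> k \<and> k \<le> n \<and> S \<in> sets borel} \<subseteq> sets M"
    using assms by (auto intro: measurable_sets)
  then show ?thesis
    unfolding subalgebra_def natural_filtration_def
    by (auto simp: space_measure_of_conv sets_measure_of_conv intro: sets.sigma_sets_subset[THEN subsetD])
qed

lemma subalgebra_natural_filtration_mono:
  assumes "m \<le> n"
  shows "subalgebra (natural_filtration M X n) (natural_filtration M X m)"
  unfolding subalgebra_def space_natural_filtration
proof
  have "{X k -` S \<inter> space M |k S. 1 \<le> k \<and> k \<le> m \<and> S \<in> sets borel}
      \<subseteq> {X k -` S \<inter> space M |k S. 1 \<le> k \<and> k \<le> n \<and> S \<in> sets borel}"
    using assms order_trans by blast
  moreover have "{X k -` S \<inter> space M |k S. 1 \<le> k \<and> k \<le> n \<and> S \<in> sets borel} \<subseteq> Pow (space M)" for n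
    by auto
  ultimately show "sets (natural_filtration M X m) \<subseteq> sets (natural_filtration M X n)"
    unfolding natural_filtration_def by (simp add: sets_measure_of sigma_sets_mono')
qed simp

lemma pos_semidef_limit:
  assumes lim: "S \<longlonglongrightarrow> L" and psd: "\<And>n. pos_semidef (S n)"
  shows "pos_semidef L"
  unfolding pos_semidef_def
proof (intro conjI allI)
  have "transpose (S n) = S n" for n using psd by (simp add: pos_semidef_def)
  then show "transpose L = L"
    using LIMSEQ_unique[OF tendsto_transpose[OF lim]] lim by simp
  fix u
  have "(\<lambda>n. u \<bullet> (S n *v u)) \<longlonglongrightarrow> u \<bullet> (L *v u)"
    by (intro tendsto_intros bounded_bilinear.tendsto[OF bounded_bilinear_matrix_vector_mult] lim)
  then show "0 \<le> u \<bullet> (L *v u)"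
    by (rule LIMSEQ_le_const) (use psd in \<open>auto simp: pos_semidef_def\<close>)
qed

lemma inverse_sqrt_tendsto_0: "(\<lambda>n. 1 / sqrt (real n)) \<longlonglongrightarrow> 0"
  by real_asymp

lemma block_matrix_tendsto:
  assumes "P \<longlonglongrightarrow> P'" "Q \<longlonglongrightarrow> Q'" "R \<longlonglongrightarrow> R'" "S \<longlonglongrightarrow> S'"
  shows "(\<lambda>n. block_matrix (P n) (Q n) (R n) (S n)) \<longlonglongrightarrow> block_matrix P' Q' R' S'"
  by (rule tendsto_matrix_entryI)
    (auto simp: block_matrix_def split: sum.split intro!: tendsto_vec_nth assms)

subsection \<open>The PolSA recursion\<close>

locale polsa_model = prob_space M
  for M :: "'w measure" +
  fixes A :: "nat \<Rightarrow> 'w \<Rightarrow> real ^ 'd ^ 'd" and b :: "nat \<Rightarrow> 'w \<Rightarrow> real ^ 'd"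
    and Abar :: "real ^ 'd ^ 'd" and bbar \<theta>s \<theta>0 :: "real ^ 'd"
    and \<theta> :: "nat \<Rightarrow> 'w \<Rightarrow> real ^ 'd"
  assumes wss: "wide_sense_stationary M (\<lambda>n \<omega>. (A n \<omega>, b n \<omega>))"
    and root: "Abar *v \<theta>s = bbar"
    and polsa: "polsa M A b Abar \<theta>0 \<theta>"
    and bounded_A: "bounded_process M (\<lambda>n \<omega>. A n \<omega> - Abar)"
    and mds_A: "martingale_difference M (filt M A b) (\<lambda>n \<omega>. A n \<omega> - Abar)"
    and bounded_b: "bounded_process M (\<lambda>n \<omega>. b n \<omega> - bbar)"
    and mds_b: "martingale_difference M (filt M A b) (\<lambda>n \<omega>. b n \<omega> - bbar)"
begin

abbreviation G where "G \<equiv> mat 1 + Abar"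

text \<open>The coefficients at time \<open>n\<close> multiply the iterate at time
  \<open>n - 1\<close>, which makes \<open>noise (Suc n)\<close> conditionally centred given
  \<open>filt M A b n\<close>.\<close>

definition noise :: "nat \<Rightarrow> 'w \<Rightarrow> real ^ 'd"
  where "noise n \<omega> = (A n \<omega> - Abar) *v \<theta> (n - 1) \<omega> - (b n \<omega> - bbar)"

text \<open>\<open>err\<close>, \<open>scaled_err\<close> and \<open>scaled_incr\<close> are the
  sequences \<open>x\<^sub>n\<close>, \<open>y\<^sub>n\<close> and \<open>v\<^sub>n\<close> of the
  overview.\<close>

definition err :: "nat \<Rightarrow> 'w \<Rightarrow> real ^ 'd"
  where "err n \<omega> = \<theta> n \<omega> - \<theta>s"

definition scaled_err :: "nat \<Rightarrow> 'w \<Rightarrow> real ^ 'd"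
  where "scaled_err n \<omega> = sqrt (real n) *\<^sub>R err n \<omega>"

definition scaled_incr :: "nat \<Rightarrow> 'w \<Rightarrow> real ^ 'd"
  where "scaled_incr n \<omega> = real n *\<^sub>R increment \<theta> n \<omega>"

text \<open>The vanishing term in the recursion for \<open>scaled_incr\<close>: the first summand
  comes from the change of scale from \<open>n\<close> to \<open>n + 1\<close>, the second is the
  mean drift.\<close>

definition remainder :: "nat \<Rightarrow> 'w \<Rightarrow> real ^ 'd"
  where "remainder n \<omega> = (1 / real n) *\<^sub>R (G *v scaled_incr n \<omega>) + Abar *v err n \<omega>"

text \<open>Centre the coefficients at their means; \<open>root\<close> turns the mean part into
  \<open>Abar *v err n \<omega>\<close>.\<close>

lemma increment_Suc:
  assumes "\<omega> \<in> space M"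
  shows "increment \<theta> (Suc n) \<omega> = G *v increment \<theta> n \<omega>
    + (1 / real (Suc n)) *\<^sub>R (Abar *v err n \<omega> + noise (Suc n) \<omega>)"
proof -
  have "A (Suc n) \<omega> *v \<theta> n \<omega> - b (Suc n) \<omega> = Abar *v err n \<omega> + noise (Suc n) \<omega>"
    by (simp add: noise_def err_def matrix_vector_mult_diff_rdistrib matrix_vector_mult_diff_distrib root)
  then show ?thesis using polsa assms by (simp add: polsa_def)
qed

lemma subalgebra_filt: "subalgebra M (filt M A b n)"
  by (rule subalgebra_natural_filtration) (rule wss_measurable[OF prob_space_axioms wss])

lemma centered_bound:
  obtains C where "C \<ge> 0" "\<And>n. n \<ge> 1 \<Longrightarrow> AE \<omega> in M. norm (A n \<omega> - Abar) \<le> C"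
    "\<And>n. n \<ge> 1 \<Longrightarrow> AE \<omega> in M. norm (b n \<omega> - bbar) \<le> C"
proof -
  obtain C where C: "\<And>n. n \<ge> 1 \<Longrightarrow> AE \<omega> in M. norm (A n \<omega> - Abar) \<le> C"
    using bounded_A unfolding bounded_process_def by blast
  obtain D where D: "\<And>n. n \<ge> 1 \<Longrightarrow> AE \<omega> in M. norm (b n \<omega> - bbar) \<le> D"
    using bounded_b unfolding bounded_process_def by blast
  show ?thesis
  proof (rule that[of "max 0 (max C D)"])
    show "AE \<omega> in M. norm (A n \<omega> - Abar) \<le> max 0 (max C D)" if "n \<ge> 1" for n
      using C[OF that] by eventually_elim auto
    show "AE \<omega> in M. norm (b n \<omega> - bbar) \<le> max 0 (max C D)" if "n \<ge> 1" for n
      using D[OF that] by eventually_elim auto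
  qed simp
qed

section \<open>Adaptedness and boundedness of the iterates\<close>

lemma ess_bounded_centered:
  assumes "n \<ge> 1"
  shows "ess_bounded M (filt M A b n) (\<lambda>\<omega>. A n \<omega> - Abar)"
    and "ess_bounded M (filt M A b n) (\<lambda>\<omega>. b n \<omega> - bbar)"
  using assms mds_A mds_b bounded_A bounded_b
  unfolding ess_bounded_def martingale_difference_def bounded_process_def by blast+

lemma ess_bounded_filt_mono:
  "ess_bounded M (filt M A b m) X \<Longrightarrow> m \<le> n \<Longrightarrow> ess_bounded M (filt M A b n) X"
  by (rule ess_bounded_subalgebra[OF _ subalgebra_natural_filtration_mono])

text \<open>The claim for the iterate is a premise here, so that the lemma can be applied inside the
  induction that proves it.\<close>

lemma ess_bounded_noise_if:
  assumes "ess_bounded M (filt M A b n) (\<theta> n)"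
  shows "ess_bounded M (filt M A b (Suc n)) (noise (Suc n))"
proof -
  have "ess_bounded M (filt M A b (Suc n))
      (\<lambda>\<omega>. (A (Suc n) \<omega> - Abar) *v \<theta> n \<omega> - (b (Suc n) \<omega> - bbar))"
    by (rule ess_bounded_diff[OF
          ess_bounded_bilinear[OF bounded_bilinear_matrix_vector_mult]])
      (auto intro!: ess_bounded_centered ess_bounded_filt_mono[OF assms])
  then show ?thesis by (simp add: noise_def[abs_def])
qed

text \<open>Strong induction, because the recursion is of second order in \<open>\<theta>\<close>.
  The start is deterministic, and each step combines finitely many essentially bounded variables.
  The bound may grow with \<open>n\<close>; uniform control in mean square comes from (N3).\<close>

lemma ess_bounded_iterate: "ess_bounded M (filt M A b n) (\<theta> n)"
proof (induction n rule: less_induct)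
  case (less n)
  show ?case
  proof (cases n)
    case 0
    have "ess_bounded M (filt M A b 0) (\<lambda>\<omega>. \<theta>0)" by (rule ess_bounded_const)
    from ess_bounded_cong[OF this] show ?thesis using polsa 0 by (simp add: polsa_def)
  next
    case (Suc m)
    have eb: "ess_bounded M (filt M A b n) (\<theta> m)" "ess_bounded M (filt M A b n) (\<theta> (m - 1))"
      using less[of m] less[of "m - 1"] Suc
      by (auto intro: ess_bounded_filt_mono[of m] ess_bounded_filt_mono[of "m - 1"])
    have "ess_bounded M (filt M A b n) (noise (Suc m))"
      using ess_bounded_noise_if[of m] less[of m] Suc by simp
    then have "ess_bounded M (filt M A b n) (\<lambda>\<omega>. \<theta> m \<omega> + (G *v (\<theta> m \<omega> - \<theta> (m - 1) \<omega>)
        + (1 / real (Suc m)) *\<^sub>R (Abar *v (\<theta> m \<omega> - \<theta>s) + noise (Suc m) \<omega>)))"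
      using eb by (intro ess_bounded_intros) auto
    then show ?thesis
    proof (rule ess_bounded_cong)
      fix \<omega> assume "\<omega> \<in> space M"
      then show "\<theta> m \<omega> + (G *v (\<theta> m \<omega> - \<theta> (m - 1) \<omega>)
          + (1 / real (Suc m)) *\<^sub>R (Abar *v (\<theta> m \<omega> - \<theta>s) + noise (Suc m) \<omega>)) = \<theta> n \<omega>"
        using increment_Suc[of \<omega> m] unfolding increment_def err_def Suc by (simp add: algebra_simps)
    qed simp
  qed
qed

lemma ess_bounded_noise: "ess_bounded M (filt M A b (Suc n)) (noise (Suc n))"
  by (rule ess_bounded_noise_if[OF ess_bounded_iterate])

lemma ess_bounded_iterate_prev: "ess_bounded M (filt M A b n) (\<theta> (n - 1))"
  using ess_bounded_filt_mono[OF ess_bounded_iterate, of "n - 1" n] by simp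

lemma ess_bounded_err: "ess_bounded M (filt M A b n) (err n)"
  unfolding err_def[abs_def] by (intro ess_bounded_intros ess_bounded_iterate)

lemma ess_bounded_scaled_err: "ess_bounded M (filt M A b n) (scaled_err n)"
  unfolding scaled_err_def[abs_def] by (intro ess_bounded_intros ess_bounded_err)

lemma ess_bounded_scaled_incr: "ess_bounded M (filt M A b n) (scaled_incr n)"
  unfolding scaled_incr_def[abs_def] increment_def
  by (intro ess_bounded_intros ess_bounded_iterate ess_bounded_iterate_prev)

lemma ess_bounded_remainder: "ess_bounded M (filt M A b n) (remainder n)"
  unfolding remainder_def[abs_def] by (intro ess_bounded_intros ess_bounded_scaled_incr ess_bounded_err)

text \<open>Later references by position: item 2 is \<open>noise\<close>, item 3 \<open>err\<close>,
  item 5 \<open>scaled_incr\<close>.\<close>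

lemmas ess_bounded_global = ess_bounded_iterate[THEN ess_bounded_subalgebra[OF _ subalgebra_filt]]
  ess_bounded_noise[THEN ess_bounded_subalgebra[OF _ subalgebra_filt]]
  ess_bounded_err[THEN ess_bounded_subalgebra[OF _ subalgebra_filt]]
  ess_bounded_scaled_err[THEN ess_bounded_subalgebra[OF _ subalgebra_filt]]
  ess_bounded_scaled_incr[THEN ess_bounded_subalgebra[OF _ subalgebra_filt]]
  ess_bounded_remainder[THEN ess_bounded_subalgebra[OF _ subalgebra_filt]]

text \<open>Entrywise, the moment is a finite sum of expectations of an entry of a centred
  coefficient times a factor known at time \<open>n\<close>, namely
  \<open>X \<omega> $ i * \<theta> n \<omega> $ k\<close> or \<open>X \<omega> $ i\<close>; each
  vanishes by orthogonality.\<close>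

lemma cross_moment_noise:
  assumes X: "ess_bounded M (filt M A b n) X"
  shows "cross_moment M X (noise (Suc n)) = 0" "cross_moment M (noise (Suc n)) X = 0"
proof -
  let ?F = "filt M A b n"
  let ?A = "\<lambda>\<omega>. A (Suc n) \<omega> - Abar" and ?b = "\<lambda>\<omega>. b (Suc n) \<omega> - bbar"
  note sub = ess_bounded_subalgebra[OF _ subalgebra_filt]
  have eb: "ess_bounded M M ?A" "ess_bounded M M ?b"
    by (rule sub[OF ess_bounded_centered(1)], simp, rule sub[OF ess_bounded_centered(2)], simp)
  have ce: "cond_exp_eq M ?F ?A (\<lambda>\<omega>. 0)" "cond_exp_eq M ?F ?b (\<lambda>\<omega>. 0)"
    using mds_A[unfolded martingale_difference_def, THEN spec, of "Suc n"]
      mds_b[unfolded martingale_difference_def, THEN spec, of "Suc n"] by simp_all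
  have comp: "ess_bounded M ?F (\<lambda>\<omega>. X \<omega> $ i)" "ess_bounded M ?F (\<lambda>\<omega>. \<theta> n \<omega> $ k)" for i k
    by (intro ess_bounded_linear[OF bounded_linear_vec_nth] X ess_bounded_iterate)+
  have prod: "ess_bounded M ?F (\<lambda>\<omega>. X \<omega> $ i * \<theta> n \<omega> $ k)" for i k
    by (rule ess_bounded_bilinear[OF bounded_bilinear_mult comp])
  have *: "(\<integral>\<omega>. (X \<omega> $ i * \<theta> n \<omega> $ k) * ?A \<omega> $ j $ k \<partial>M) = 0" for i j k
    using martingale_difference_orthogonal[OF subalgebra_filt prod eb(1) ce(1), of "axis j (axis k 1)"]
    by (simp add: inner_axis axis_in_Basis_iff)
  have **: "(\<integral>\<omega>. X \<omega> $ i * ?b \<omega> $ j \<partial>M) = 0" for i j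
    using martingale_difference_orthogonal[OF subalgebra_filt comp(1) eb(2) ce(2), of "axis j 1"]
    by (simp add: inner_axis axis_in_Basis_iff)
  have int: "integrable M (\<lambda>\<omega>. (X \<omega> $ i * \<theta> n \<omega> $ k) * ?A \<omega> $ j $ k)"
      "integrable M (\<lambda>\<omega>. X \<omega> $ i * ?b \<omega> $ j)" for i j k
    by (intro ess_bounded_integrable ess_bounded_bilinear[OF bounded_bilinear_mult]
        sub[OF prod] sub[OF comp(1)]
        ess_bounded_linear[OF bounded_linear_compose[OF bounded_linear_vec_nth bounded_linear_vec_nth] eb(1)]
        ess_bounded_linear[OF bounded_linear_vec_nth eb(2)])+
  have "cross_moment M X (noise (Suc n)) $ i $ j = 0" for i j
  proof -
    have "cross_moment M X (noise (Suc n)) $ i $ j = (\<integral>\<omega>. X \<omega> $ i * noise (Suc n) \<omega> $ j \<partial>M)"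
      by (rule cross_moment_entry[OF sub[OF X] ess_bounded_global(2)])
    also have "\<dots> = (\<integral>\<omega>. (\<Sum>k\<in>UNIV. (X \<omega> $ i * \<theta> n \<omega> $ k) * ?A \<omega> $ j $ k) - X \<omega> $ i * ?b \<omega> $ j \<partial>M)"
      by (intro Bochner_Integration.integral_cong refl)
        (simp add: noise_def matrix_vector_mult_def right_diff_distrib sum_distrib_left mult_ac)
    also have "\<dots> = 0"
      by (subst Bochner_Integration.integral_diff)
        (simp_all only: int Bochner_Integration.integrable_sum Bochner_Integration.integral_sum
          * ** sum.neutral_const diff_self)
    finally show ?thesis .
  qed
  then show "cross_moment M X (noise (Suc n)) = 0" by (simp add: vec_eq_iff)
  from arg_cong[OF this, of transpose] show "cross_moment M (noise (Suc n)) X = 0"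
    by (simp add: transpose_cross_moment[OF sub[OF X] ess_bounded_global(2)])
      (simp add: transpose_def vec_eq_iff)
qed

lemma cross_moment_add_noise:
  assumes X: "ess_bounded M (filt M A b n) X"
  shows "cross_moment M (\<lambda>\<omega>. X \<omega> + noise (Suc n) \<omega>) (\<lambda>\<omega>. X \<omega> + noise (Suc n) \<omega>)
    = cross_moment M X X + cross_moment M (noise (Suc n)) (noise (Suc n))"
  using cross_moment_add_self[OF ess_bounded_subalgebra[OF X subalgebra_filt] ess_bounded_global(2)]
  by (simp add: cross_moment_noise[OF X])

section \<open>One-step recursions for the scaled quantities\<close>

lemma scaled_incr_Suc:
  assumes "\<omega> \<in> space M" "n \<ge> 1"
  shows "scaled_incr (Suc n) \<omega> = (G *v scaled_incr n \<omega> + remainder n \<omega>) + noise (Suc n) \<omega>"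
proof -
  have "scaled_incr (Suc n) \<omega>
      = real (Suc n) *\<^sub>R (G *v increment \<theta> n \<omega>) + (Abar *v err n \<omega> + noise (Suc n) \<omega>)"
    unfolding scaled_incr_def increment_Suc[OF assms(1)] by (simp add: scaleR_add_right)
  \<comment> \<open>The additional unit in \<open>Suc n\<close> leaves one unscaled increment, which
    is \<open>scaled_incr n \<omega>\<close> divided by \<open>n\<close>; it is absorbed by
    \<open>remainder\<close>.\<close>
  moreover have "real (Suc n) *\<^sub>R (G *v increment \<theta> n \<omega>)
      = G *v scaled_incr n \<omega> + (1 / real n) *\<^sub>R (G *v scaled_incr n \<omega>)"
    using assms(2) by (simp add: scaled_incr_def matrix_vector_mult_scaleR scaleR_add_left)
  ultimately show ?thesis by (simp add: remainder_def)
qed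

lemma scaled_err_Suc:
  assumes "n \<ge> 1"
  shows "scaled_err (Suc n) \<omega> = (sqrt (real (Suc n)) / sqrt (real n)) *\<^sub>R scaled_err n \<omega>
    + (1 / sqrt (real (Suc n))) *\<^sub>R scaled_incr (Suc n) \<omega>"
proof -
  have "err (Suc n) \<omega> = err n \<omega> + increment \<theta> (Suc n) \<omega>"
    by (simp add: err_def increment_def)
  moreover have "real (Suc n) / sqrt (real (Suc n)) = sqrt (real (Suc n))" by (rule real_div_sqrt) simp
  ultimately show ?thesis
    using assms by (simp add: scaled_err_def scaled_incr_def scaleR_add_right)
qed

text \<open>Summing the recursion by parts exhibits \<open>- n A (\<theta>\<^sub>n - \<theta>*)\<close>, up to bounded terms, as a
  martingale whose increments are the noise.\<close>

definition summed_noise :: "nat \<Rightarrow> 'w \<Rightarrow> real ^ 'd"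
  where "summed_noise n \<omega> =
    - (real n *\<^sub>R (Abar *v err n \<omega>)) + (G *v scaled_incr n \<omega> - G *v err (n - 1) \<omega>)"

text \<open>Writing \<open>G *v ?V'\<close> as \<open>?V' + Abar *v ?V'\<close>, the second part is
  a difference of consecutive errors and cancels the leading term at time \<open>Suc n\<close>. In
  \<open>?V'\<close> itself, the scale correction \<open>(1 / real n) *\<^sub>R (G *v ?V)\<close> is
  again a difference of errors, so all terms but the noise regroup into
  \<open>summed_noise n \<omega>\<close>.\<close>

lemma summed_noise_Suc:
  assumes "\<omega> \<in> space M" "n \<ge> 1"
  shows "summed_noise (Suc n) \<omega> = summed_noise n \<omega> + noise (Suc n) \<omega>"
proof -
  let ?V = "scaled_incr n \<omega>" and ?V' = "scaled_incr (Suc n) \<omega>"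
  have V': "?V' = real (Suc n) *\<^sub>R (err (Suc n) \<omega> - err n \<omega>)"
    by (simp add: scaled_incr_def increment_def err_def)
  have "(1 / real n) *\<^sub>R ?V = err n \<omega> - err (n - 1) \<omega>"
    using assms(2) by (simp add: scaled_incr_def increment_def err_def)
  then have V: "(1 / real n) *\<^sub>R (G *v ?V) = G *v err n \<omega> - G *v err (n - 1) \<omega>"
    by (metis matrix_vector_mult_scaleR matrix_vector_mult_diff_distrib)
  have "Abar *v ?V' = real (Suc n) *\<^sub>R (Abar *v err (Suc n) \<omega>) - real (Suc n) *\<^sub>R (Abar *v err n \<omega>)"
    unfolding V' by (simp only: matrix_vector_mult_scaleR matrix_vector_mult_diff_distrib scaleR_diff_right)
  moreover have "G *v ?V' = ?V' + Abar *v ?V'" by (simp add: matrix_vector_mult_add_rdistrib)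
  ultimately have "summed_noise (Suc n) \<omega> = ?V' - real (Suc n) *\<^sub>R (Abar *v err n \<omega>) - G *v err n \<omega>"
    by (simp add: summed_noise_def)
  also have "?V' = G *v ?V + (G *v err n \<omega> - G *v err (n - 1) \<omega>) + Abar *v err n \<omega> + noise (Suc n) \<omega>"
    using scaled_incr_Suc[OF assms] unfolding remainder_def V by simp
  finally show ?thesis by (simp add: summed_noise_def scaleR_add_left)
qed

lemma ess_bounded_err_prev: "ess_bounded M (filt M A b n) (err (n - 1))"
  using ess_bounded_filt_mono[OF ess_bounded_err, of "n - 1" n] by simp

lemma ess_bounded_summed_noise: "ess_bounded M (filt M A b n) (summed_noise n)"
proof -
  have "ess_bounded M (filt M A b n) (\<lambda>\<omega>. (- real n) *\<^sub>R (Abar *v err n \<omega>)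
      + (G *v scaled_incr n \<omega> - G *v err (n - 1) \<omega>))"
    by (intro ess_bounded_intros ess_bounded_scaled_incr ess_bounded_err ess_bounded_err_prev)
  then show ?thesis by (simp add: summed_noise_def[abs_def])
qed

subsection \<open>Block decomposition of the covariance\<close>

text \<open>The state is a sum of two linear embeddings of the scaled error and increment. It is
  therefore essentially bounded, and its covariance can be read entry by entry.\<close>

lemma state_cov_blocks:
  "state_cov M \<theta> \<theta>s n = block_matrix
     (cross_moment M (scaled_err n) (scaled_err n)) (cross_moment M (scaled_err n) (scaled_incr n))
     (cross_moment M (scaled_incr n) (scaled_err n)) (cross_moment M (scaled_incr n) (scaled_incr n))"
proof -
  let ?E = "\<lambda>z :: real ^ 'd. (\<chi> i. case i of Inl k \<Rightarrow> z $ k | Inr k \<Rightarrow> 0) :: real ^ ('d + 'd)"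
  let ?I = "\<lambda>z :: real ^ 'd. (\<chi> i. case i of Inl k \<Rightarrow> 0 | Inr k \<Rightarrow> z $ k) :: real ^ ('d + 'd)"
  have bl: "bounded_linear ?E" "bounded_linear ?I"
    unfolding linear_conv_bounded_linear[symmetric]
    by (auto intro!: linearI simp: vec_eq_iff split: sum.split)
  have state: "scaled_state \<theta> \<theta>s n = (\<lambda>\<omega>. ?E (scaled_err n \<omega>) + ?I (scaled_incr n \<omega>))"
    by (auto simp: fun_eq_iff vec_eq_iff scaled_state_def scaled_err_def scaled_incr_def err_def
        split: sum.split)
  have eb: "ess_bounded M M (scaled_state \<theta> \<theta>s n)"
    unfolding state by (intro ess_bounded_add ess_bounded_linear[OF bl(1)]
        ess_bounded_linear[OF bl(2)] ess_bounded_global)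
  have "state_cov M \<theta> \<theta>s n = cross_moment M (scaled_state \<theta> \<theta>s n) (scaled_state \<theta> \<theta>s n)"
    by (simp add: state_cov_def cross_moment_def)
  then have "state_cov M \<theta> \<theta>s n $ i $ j = (\<integral>\<omega>. scaled_state \<theta> \<theta>s n \<omega> $ i * scaled_state \<theta> \<theta>s n \<omega> $ j \<partial>M)"
    for i j by (simp only: cross_moment_entry[OF eb eb])
  then show ?thesis
    by (auto simp: vec_eq_iff block_matrix_def cross_moment_entry ess_bounded_global state
        split: sum.split)
qed

end

subsection \<open>Limits of the blocks\<close>

context polsa_model
begin

text \<open>The noise is \<open>target_noise\<close>, whose covariance does not depend on time, plus
  the centred matrix applied to \<open>err n\<close>. Since the centred matrices are uniformly
  bounded, the latter vanishes in mean square.\<close>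

lemma noise_cov_tendsto:
  assumes "(\<lambda>n. l2_norm M (err n)) \<longlonglongrightarrow> 0"
  shows "(\<lambda>n. cross_moment M (noise (Suc n)) (noise (Suc n))) \<longlonglongrightarrow> noise_cov M A b \<theta>s"
proof -
  obtain C where C: "C \<ge> 0" "\<And>n. n \<ge> 1 \<Longrightarrow> AE \<omega> in M. norm (A n \<omega> - Abar) \<le> C"
      "\<And>n. n \<ge> 1 \<Longrightarrow> AE \<omega> in M. norm (b n \<omega> - bbar) \<le> C"
    using centered_bound by blast
  obtain K where K: "K \<ge> 0"
      "\<And>(B :: real ^ 'd ^ 'd) (z :: real ^ 'd). norm (B *v z) \<le> norm B * norm z * K"
    using bounded_bilinear.nonneg_bounded[OF bounded_bilinear_matrix_vector_mult] by blast
  let ?N = "\<lambda>n. target_noise A b \<theta>s (Suc n)"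
  let ?E = "\<lambda>n \<omega>. (A (Suc n) \<omega> - Abar) *v err n \<omega>"
  note sub = ess_bounded_subalgebra[OF _ subalgebra_filt]
  have eb: "ess_bounded M M (\<lambda>\<omega>. A (Suc n) \<omega> - Abar)" "ess_bounded M M (\<lambda>\<omega>. b (Suc n) \<omega> - bbar)" for n
    by (rule sub[OF ess_bounded_centered(1)], simp, rule sub[OF ess_bounded_centered(2)], simp)
  \<comment> \<open>\<open>target_noise\<close> is already centred, because \<open>\<theta>s\<close>
    solves the mean equation.\<close>
  have N_eq: "?N n \<omega> = (A (Suc n) \<omega> - Abar) *v \<theta>s - (b (Suc n) \<omega> - bbar)" for n \<omega>
    by (simp add: target_noise_def matrix_vector_mult_diff_rdistrib root)
  have N: "ess_bounded M M (?N n)" for n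
    unfolding N_eq[abs_def]
    by (intro ess_bounded_diff ess_bounded_bilinear[OF bounded_bilinear_matrix_vector_mult]
        eb ess_bounded_const)
  have E: "ess_bounded M M (?E n)" for n
    by (intro ess_bounded_bilinear[OF bounded_bilinear_matrix_vector_mult] eb ess_bounded_global)
  have N_bound: "l2_norm M (?N n) \<le> C * norm \<theta>s * K + C" for n
  proof (rule l2_norm_const_bound[OF N])
    have "AE \<omega> in M. norm (A (Suc n) \<omega> - Abar) \<le> C" "AE \<omega> in M. norm (b (Suc n) \<omega> - bbar) \<le> C"
      using C(2,3)[of "Suc n"] by simp_all
    then show "AE \<omega> in M. norm (?N n \<omega>) \<le> C * norm \<theta>s * K + C"
    proof eventually_elim
      case (elim \<omega>)
      have "norm ((A (Suc n) \<omega> - Abar) *v \<theta>s) \<le> C * norm \<theta>s * K"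
        by (rule order_trans[OF K(2)]) (use elim K(1) in \<open>auto intro!: mult_right_mono\<close>)
      then show ?case
        unfolding N_eq using elim(2) norm_triangle_ineq4 order_trans add_mono by metis
    qed
  qed (use C K in auto)
  have E_lim: "(\<lambda>n. l2_norm M (?E n)) \<longlonglongrightarrow> 0"
  proof (rule l2_norm_tendsto_0I)
    have "l2_norm M (?E n) \<le> (C * K) * l2_norm M (err n)" for n
    proof (rule l2_norm_mono[OF E ess_bounded_global(3)])
      have "AE \<omega> in M. norm (A (Suc n) \<omega> - Abar) \<le> C" using C(2)[of "Suc n"] by simp
      then show "AE \<omega> in M. norm (?E n \<omega>) \<le> (C * K) * norm (err n \<omega>)"
      proof eventually_elim
        case (elim \<omega>)
        have "norm (?E n \<omega>) \<le> C * norm (err n \<omega>) * K"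
          by (rule order_trans[OF K(2)]) (use elim K(1) in \<open>auto intro!: mult_right_mono\<close>)
        then show ?case by (simp add: mult_ac)
      qed
    qed (use C K in auto)
    then show "\<forall>\<^sub>F n in sequentially. l2_norm M (?E n) \<le> (C * K) * l2_norm M (err n)" by simp
    show "(\<lambda>n. (C * K) * l2_norm M (err n)) \<longlonglongrightarrow> 0" by (rule tendsto_mult_right_zero[OF assms])
  qed
  have eq: "noise (Suc n) = (\<lambda>\<omega>. ?N n \<omega> + ?E n \<omega>)" for n
    by (simp add: fun_eq_iff noise_def N_eq err_def matrix_vector_mult_diff_distrib)
  have "cross_moment M (?N n) (?N n) = noise_cov M A b \<theta>s" for n
    using noise_cov_time_invariant(2)[OF prob_space_axioms wss, of "Suc n" \<theta>s]
    by (simp add: cross_moment_def)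
  then have "(\<lambda>n. cross_moment M (noise (Suc n)) (noise (Suc n)) - noise_cov M A b \<theta>s) \<longlonglongrightarrow> 0"
    using cross_moment_perturbation_tendsto_0[OF N E N_bound E_lim] by (simp add: eq)
  then show ?thesis by (rule LIM_zero_cancel)
qed

section \<open>Consequences of the boundedness of the covariances\<close>

context
  assumes state_bounded: "bounded (range (state_cov M \<theta> \<theta>s))"
begin

text \<open>The squared mean square norm is the trace of the second moment matrix, whose diagonal
  entries are entries of \<open>state_cov\<close>.\<close>

lemma l2_norms_bounded:
  obtains K where "\<And>n. l2_norm M (scaled_err n) \<le> K" "\<And>n. l2_norm M (scaled_incr n) \<le> K"
proof -
  obtain B where B: "\<And>n. norm (state_cov M \<theta> \<theta>s n) \<le> B"
    using state_bounded unfolding bounded_iff by blast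
  have entry: "\<bar>state_cov M \<theta> \<theta>s n $ i $ j\<bar> \<le> B" for n i j
    using B[of n] component_le_norm_cart[of "state_cov M \<theta> \<theta>s n $ i" j]
      Finite_Cartesian_Product.norm_nth_le[of "state_cov M \<theta> \<theta>s n" i] by linarith
  have diag: "(l2_norm M X)\<^sup>2 = (\<Sum>k\<in>UNIV. cross_moment M X X $ k $ k)"
    if X: "ess_bounded M M X" for X :: "'w \<Rightarrow> real ^ 'd"
  proof -
    have "integrable M (\<lambda>\<omega>. X \<omega> $ k * X \<omega> $ k)" for k
      by (intro ess_bounded_integrable ess_bounded_bilinear[OF bounded_bilinear_mult]
          ess_bounded_linear[OF bounded_linear_vec_nth] X)
    then show ?thesis
      by (simp add: l2_norm_square cross_moment_entry[OF X X] power2_norm_eq_inner inner_vec_def)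
  qed
  define K where "K = sqrt (CARD('d) * B)"
  have *: "l2_norm M X \<le> K" if "ess_bounded M M X" "\<And>k. cross_moment M X X $ k $ k \<le> B"
    for X :: "'w \<Rightarrow> real ^ 'd"
  proof -
    have "(l2_norm M X)\<^sup>2 \<le> CARD('d) * B"
      unfolding diag[OF that(1)] using sum_bounded_above[of UNIV "\<lambda>k. cross_moment M X X $ k $ k" B, OF that(2)] by simp
    then show ?thesis unfolding K_def by (rule real_le_rsqrt)
  qed
  have "cross_moment M (scaled_err n) (scaled_err n) $ k $ k \<le> B" for n k
    using entry[of n "Inl k" "Inl k"] by (simp add: state_cov_blocks block_matrix_def)
  moreover have "cross_moment M (scaled_incr n) (scaled_incr n) $ k $ k \<le> B" for n k
    using entry[of n "Inr k" "Inr k"] by (simp add: state_cov_blocks block_matrix_def)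
  ultimately show ?thesis by (intro that[of K] * ess_bounded_global)
qed

text \<open>For positive \<open>n\<close>, the error is \<open>scaled_err n\<close> divided by
  \<open>sqrt (real n)\<close>, and the numerator is bounded in mean square.\<close>

lemma err_tendsto_0: "(\<lambda>n. l2_norm M (err n)) \<longlonglongrightarrow> 0"
proof -
  obtain K where K: "\<And>n. l2_norm M (scaled_err n) \<le> K" using l2_norms_bounded by metis
  have "\<forall>\<^sub>F n in sequentially. l2_norm M (\<lambda>\<omega>. (1 / sqrt (real n)) *\<^sub>R scaled_err n \<omega>) = l2_norm M (err n)"
    using eventually_gt_at_top[of 0] by eventually_elim (simp add: scaled_err_def)
  from Lim_transform_eventually[OF l2_norm_scaleR_tendsto_0[OF inverse_sqrt_tendsto_0 K] this]
  show ?thesis .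
qed

lemma remainder_tendsto_0: "(\<lambda>n. l2_norm M (remainder n)) \<longlonglongrightarrow> 0"
proof -
  obtain K where K: "\<And>n. l2_norm M (scaled_incr n) \<le> K" using l2_norms_bounded by metis
  show ?thesis
    unfolding remainder_def[abs_def]
    by (intro l2_norm_add_tendsto_0 l2_norm_matrix_tendsto_0 err_tendsto_0 ess_bounded_intros
        ess_bounded_global l2_norm_scaleR_tendsto_0[OF lim_1_over_n l2_norm_matrix_le[OF _ K]])
qed

text \<open>The noise is orthogonal to everything known at time \<open>n\<close>, so it contributes
  exactly its own covariance; \<open>remainder\<close> changes the covariance of the other part only
  by a null sequence.\<close>

lemma scaled_incr_cov_recursion:
  "(\<lambda>n. cross_moment M (scaled_incr (Suc n)) (scaled_incr (Suc n))
     - G ** cross_moment M (scaled_incr n) (scaled_incr n) ** transpose G)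
   \<longlonglongrightarrow> noise_cov M A b \<theta>s"
proof -
  obtain K where K: "\<And>n. l2_norm M (scaled_incr n) \<le> K" using l2_norms_bounded by metis
  let ?GV = "\<lambda>n \<omega>. G *v scaled_incr n \<omega>"
  have GV: "ess_bounded M M (?GV n)" "l2_norm M (?GV n) \<le> onorm ((*v) G) * K" for n
    by (intro ess_bounded_intros ess_bounded_global l2_norm_matrix_le K)+
  have "(\<lambda>n. (cross_moment M (\<lambda>\<omega>. ?GV n \<omega> + remainder n \<omega>) (\<lambda>\<omega>. ?GV n \<omega> + remainder n \<omega>)
        - cross_moment M (?GV n) (?GV n)) + cross_moment M (noise (Suc n)) (noise (Suc n)))
      \<longlonglongrightarrow> 0 + noise_cov M A b \<theta>s"
    by (intro tendsto_add noise_cov_tendsto err_tendsto_0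
        cross_moment_perturbation_tendsto_0[OF GV(1) _ GV(2)] ess_bounded_global remainder_tendsto_0)
  then have lim: "(\<lambda>n. (cross_moment M (\<lambda>\<omega>. ?GV n \<omega> + remainder n \<omega>) (\<lambda>\<omega>. ?GV n \<omega> + remainder n \<omega>)
        - cross_moment M (?GV n) (?GV n)) + cross_moment M (noise (Suc n)) (noise (Suc n)))
      \<longlonglongrightarrow> noise_cov M A b \<theta>s" by simp
  show ?thesis
  proof (rule Lim_transform_eventually[OF lim], use eventually_ge_at_top[of 1] in eventually_elim)
    fix n :: nat assume n: "n \<ge> 1"
    have "cross_moment M (scaled_incr (Suc n)) (scaled_incr (Suc n))
        = cross_moment M (\<lambda>\<omega>. (?GV n \<omega> + remainder n \<omega>) + noise (Suc n) \<omega>)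
            (\<lambda>\<omega>. (?GV n \<omega> + remainder n \<omega>) + noise (Suc n) \<omega>)"
      by (intro cross_moment_cong scaled_incr_Suc n)
    also have "\<dots> = cross_moment M (\<lambda>\<omega>. ?GV n \<omega> + remainder n \<omega>) (\<lambda>\<omega>. ?GV n \<omega> + remainder n \<omega>)
        + cross_moment M (noise (Suc n)) (noise (Suc n))"
      by (intro cross_moment_add_noise ess_bounded_intros ess_bounded_scaled_incr ess_bounded_remainder)
    moreover have "cross_moment M (?GV n) (?GV n)
        = G ** cross_moment M (scaled_incr n) (scaled_incr n) ** transpose G"
      by (simp add: cross_moment_matrix_left cross_moment_matrix_right ess_bounded_matrix
          ess_bounded_global matrix_mul_assoc)
    ultimately show "(cross_moment M (\<lambda>\<omega>. ?GV n \<omega> + remainder n \<omega>) (\<lambda>\<omega>. ?GV n \<omega> + remainder n \<omega>)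
        - cross_moment M (?GV n) (?GV n)) + cross_moment M (noise (Suc n)) (noise (Suc n))
      = cross_moment M (scaled_incr (Suc n)) (scaled_incr (Suc n))
     - G ** cross_moment M (scaled_incr n) (scaled_incr n) ** transpose G"
      by (simp add: algebra_simps)
  qed
qed

text \<open>Expand the new error by \<open>scaled_err_Suc\<close>. Its share of the new increment
  carries a factor tending to zero; in the product of old error and new increment the noise drops
  out by orthogonality, which leaves the old cross moment times \<open>transpose G\<close>.\<close>

lemma cross_cov_recursion:
  "(\<lambda>n. cross_moment M (scaled_err (Suc n)) (scaled_incr (Suc n))
     - cross_moment M (scaled_err n) (scaled_incr n) ** transpose G) \<longlonglongrightarrow> 0"
proof -
  obtain K where K: "\<And>n. l2_norm M (scaled_err n) \<le> K" "\<And>n. l2_norm M (scaled_incr n) \<le> K"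
    using l2_norms_bounded by metis
  let ?GV = "\<lambda>n \<omega>. G *v scaled_incr n \<omega>"
  let ?\<rho> = "\<lambda>n. sqrt (real (Suc n)) / sqrt (real n)"
  let ?\<sigma> = "\<lambda>n. 1 / sqrt (real (Suc n))"
  have \<rho>: "?\<rho> \<longlonglongrightarrow> 1" "(\<lambda>n. ?\<rho> n - 1) \<longlonglongrightarrow> 0" and \<sigma>: "?\<sigma> \<longlonglongrightarrow> 0"
    by real_asymp+
  have GV: "ess_bounded M M (?GV n)" "l2_norm M (?GV n) \<le> onorm ((*v) G) * K" for n
    by (intro ess_bounded_intros ess_bounded_global l2_norm_matrix_le K)+
  \<comment> \<open>The exact discrepancy: rescaling of the old error, the \<open>remainder\<close>,
    and the share of the new increment in the new error.\<close>
  let ?L = "\<lambda>n. cross_moment M (\<lambda>\<omega>. (?\<rho> n - 1) *\<^sub>R scaled_err n \<omega>) (?GV n)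
      + ?\<rho> n *\<^sub>R cross_moment M (scaled_err n) (remainder n)
      + cross_moment M (\<lambda>\<omega>. ?\<sigma> n *\<^sub>R scaled_incr (Suc n) \<omega>) (scaled_incr (Suc n))"
  have "?L \<longlonglongrightarrow> 0 + 1 *\<^sub>R 0 + 0"
  proof (intro tendsto_add tendsto_scaleR \<rho>)
    show "(\<lambda>n. cross_moment M (\<lambda>\<omega>. (?\<rho> n - 1) *\<^sub>R scaled_err n \<omega>) (?GV n)) \<longlonglongrightarrow> 0"
      by (rule cross_moment_tendsto_0(2)[OF GV(1) _ GV(2) l2_norm_scaleR_tendsto_0[OF \<rho>(2) K(1)]])
        (intro ess_bounded_intros ess_bounded_global)
    show "(\<lambda>n. cross_moment M (scaled_err n) (remainder n)) \<longlonglongrightarrow> 0"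
      by (rule cross_moment_tendsto_0(1)[OF _ _ K(1) remainder_tendsto_0]) (rule ess_bounded_global)+
    show "(\<lambda>n. cross_moment M (\<lambda>\<omega>. ?\<sigma> n *\<^sub>R scaled_incr (Suc n) \<omega>) (scaled_incr (Suc n))) \<longlonglongrightarrow> 0"
      by (rule cross_moment_tendsto_0(2)[OF _ _ K(2) l2_norm_scaleR_tendsto_0[OF \<sigma> K(2)]])
        (intro ess_bounded_intros ess_bounded_global)+
  qed
  then have lim: "?L \<longlonglongrightarrow> 0" by simp
  show ?thesis
  proof (rule Lim_transform_eventually[OF lim], use eventually_ge_at_top[of 1] in eventually_elim)
    fix n :: nat assume n: "n \<ge> 1"
    have "cross_moment M (scaled_err (Suc n)) (scaled_incr (Suc n))
        = cross_moment M (\<lambda>\<omega>. ?\<rho> n *\<^sub>R scaled_err n \<omega> + ?\<sigma> n *\<^sub>R scaled_incr (Suc n) \<omega>) (scaled_incr (Suc n))"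
      by (intro cross_moment_cong scaled_err_Suc n refl)
    also have "\<dots> = ?\<rho> n *\<^sub>R cross_moment M (scaled_err n) (scaled_incr (Suc n))
        + cross_moment M (\<lambda>\<omega>. ?\<sigma> n *\<^sub>R scaled_incr (Suc n) \<omega>) (scaled_incr (Suc n))"
      by (simp only: cross_moment_add_left ess_bounded_scaleR ess_bounded_global
          cross_moment_scaleR_left[of "?\<rho> n"])
    also have "cross_moment M (scaled_err n) (scaled_incr (Suc n))
        = cross_moment M (scaled_err n) (\<lambda>\<omega>. (?GV n \<omega> + remainder n \<omega>) + noise (Suc n) \<omega>)"
      by (intro cross_moment_cong scaled_incr_Suc n refl)
    also have "\<dots> = cross_moment M (scaled_err n) (?GV n) + cross_moment M (scaled_err n) (remainder n)"
      by (simp add: cross_moment_add_right ess_bounded_add ess_bounded_global GV(1)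
          cross_moment_noise(1)[OF ess_bounded_scaled_err])
    finally have step: "cross_moment M (scaled_err (Suc n)) (scaled_incr (Suc n))
      = ?\<rho> n *\<^sub>R cross_moment M (scaled_err n) (?GV n)
        + ?\<rho> n *\<^sub>R cross_moment M (scaled_err n) (remainder n)
        + cross_moment M (\<lambda>\<omega>. ?\<sigma> n *\<^sub>R scaled_incr (Suc n) \<omega>) (scaled_incr (Suc n))"
      by (simp only: scaleR_add_right)
    have "cross_moment M (scaled_err n) (?GV n) = cross_moment M (scaled_err n) (scaled_incr n) ** transpose G"
      by (intro cross_moment_matrix_right ess_bounded_global)
    then show "?L n = cross_moment M (scaled_err (Suc n)) (scaled_incr (Suc n))
        - cross_moment M (scaled_err n) (scaled_incr n) ** transpose G"
      unfolding step cross_moment_scaleR_left[of "?\<rho> n - 1"] by (simp only: scaleR_diff_left scaleR_one) simp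
  qed
qed

text \<open>Orthogonality makes the increments of this covariance equal to the noise covariances
  from index 1 on, and these converge; averaging keeps the limit.\<close>

lemma summed_noise_cov_tendsto:
  "(\<lambda>n. (1 / real n) *\<^sub>R cross_moment M (summed_noise n) (summed_noise n)) \<longlonglongrightarrow> noise_cov M A b \<theta>s"
proof (rule increments_tendsto_imp_average_tendsto,
    rule Lim_transform_eventually[OF noise_cov_tendsto[OF err_tendsto_0]],
    use eventually_ge_at_top[of 1] in eventually_elim)
  fix n :: nat assume n: "n \<ge> 1"
  have "cross_moment M (summed_noise (Suc n)) (summed_noise (Suc n))
      = cross_moment M (\<lambda>\<omega>. summed_noise n \<omega> + noise (Suc n) \<omega>) (\<lambda>\<omega>. summed_noise n \<omega> + noise (Suc n) \<omega>)"
    by (intro cross_moment_cong summed_noise_Suc n)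
  then show "cross_moment M (noise (Suc n)) (noise (Suc n))
      = cross_moment M (summed_noise (Suc n)) (summed_noise (Suc n)) - cross_moment M (summed_noise n) (summed_noise n)"
    by (simp add: cross_moment_add_noise ess_bounded_summed_noise)
qed

text \<open>Dividing \<open>summed_noise n\<close> by \<open>sqrt (real n)\<close> leaves
  \<open>- Abar\<close> times the scaled error plus boundary terms that vanish in mean
  square.\<close>

lemma scaled_err_cov_tendsto:
  "(\<lambda>n. Abar ** cross_moment M (scaled_err n) (scaled_err n) ** transpose Abar) \<longlonglongrightarrow> noise_cov M A b \<theta>s"
proof -
  obtain K where K: "\<And>n. l2_norm M (scaled_err n) \<le> K" "\<And>n. l2_norm M (scaled_incr n) \<le> K"
    using l2_norms_bounded by metis
  let ?Y = "\<lambda>n \<omega>. (- Abar) *v scaled_err n \<omega>"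
  let ?P = "\<lambda>n \<omega>. (1 / sqrt (real n)) *\<^sub>R (G *v scaled_incr n \<omega>) + (- (1 / sqrt (real n))) *\<^sub>R (G *v err (n - 1) \<omega>)"
  have Y: "ess_bounded M M (?Y n)" "l2_norm M (?Y n) \<le> onorm ((*v) (- Abar)) * K" for n
    by (intro ess_bounded_intros ess_bounded_global l2_norm_matrix_le K)+
  have P: "ess_bounded M M (?P n)" for n by (intro ess_bounded_intros ess_bounded_global)
  obtain B where B: "\<And>n. l2_norm M (err n) \<le> B"
    using convergent_imp_Bseq[OF convergentI[OF err_tendsto_0]] by (metis BseqE abs_le_D1 real_norm_def)
  have s: "(\<lambda>n. - (1 / sqrt (real n))) \<longlonglongrightarrow> 0" using tendsto_minus[OF inverse_sqrt_tendsto_0] by simp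
  have P_lim: "(\<lambda>n. l2_norm M (?P n)) \<longlonglongrightarrow> 0"
    by (intro l2_norm_add_tendsto_0 ess_bounded_intros ess_bounded_global
        l2_norm_scaleR_tendsto_0[OF inverse_sqrt_tendsto_0 l2_norm_matrix_le[OF _ K(2)]]
        l2_norm_scaleR_tendsto_0[OF s l2_norm_matrix_le[OF _ B]])
  have eq: "(1 / sqrt (real n)) *\<^sub>R summed_noise n \<omega> = ?Y n \<omega> + ?P n \<omega>" for n \<omega>
  proof -
    \<comment> \<open>Also valid at \<open>n = 0\<close>, where division by zero makes both sides
      zero.\<close>
    have "1 / sqrt (real n) * real n = sqrt (real n)" by (simp add: real_div_sqrt)
    then have "(1 / sqrt (real n)) *\<^sub>R (real n *\<^sub>R (Abar *v err n \<omega>)) = Abar *v scaled_err n \<omega>"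
      by (simp only: scaleR_scaleR scaled_err_def matrix_vector_mult_scaleR)
    moreover have "?Y n \<omega> = - (Abar *v scaled_err n \<omega>)"
      by (simp add: matrix_vector_mult_def vec_eq_iff sum_negf)
    ultimately show ?thesis
      by (simp only: summed_noise_def scaleR_add_right scaleR_minus_right scaleR_diff_right scaleR_minus_left)
        simp
  qed
  have avg: "(1 / real n) *\<^sub>R cross_moment M (summed_noise n) (summed_noise n)
      = cross_moment M (\<lambda>\<omega>. ?Y n \<omega> + ?P n \<omega>) (\<lambda>\<omega>. ?Y n \<omega> + ?P n \<omega>)" for n
    unfolding eq[symmetric] cross_moment_scaleR_left cross_moment_scaleR_right by simp
  have YY: "cross_moment M (?Y n) (?Y n)
      = Abar ** cross_moment M (scaled_err n) (scaled_err n) ** transpose Abar" for n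
  proof -
    have "?Y n = (\<lambda>\<omega>. (-1) *\<^sub>R (Abar *v scaled_err n \<omega>))"
      by (simp add: fun_eq_iff matrix_vector_mult_def vec_eq_iff sum_negf)
    then show ?thesis
      by (simp only: cross_moment_scaleR_left cross_moment_scaleR_right)
        (simp add: cross_moment_matrix_left cross_moment_matrix_right ess_bounded_matrix
          ess_bounded_global matrix_mul_assoc)
  qed
  have "(\<lambda>n. (1 / real n) *\<^sub>R cross_moment M (summed_noise n) (summed_noise n)
      - (cross_moment M (\<lambda>\<omega>. ?Y n \<omega> + ?P n \<omega>) (\<lambda>\<omega>. ?Y n \<omega> + ?P n \<omega>) - cross_moment M (?Y n) (?Y n)))
      \<longlonglongrightarrow> noise_cov M A b \<theta>s - 0"
    by (intro tendsto_diff summed_noise_cov_tendsto cross_moment_perturbation_tendsto_0[OF Y(1) P Y(2) P_lim])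
  then show ?thesis by (simp add: avg YY)
qed

text \<open>The two descriptions of the upper diagonal block have different sources: the one through
  the noise covariance is the limit obtained from \<open>scaled_err_cov_tendsto\<close>, the one
  through \<open>S22\<close> follows from the Lyapunov equation by algebra.\<close>

lemma state_cov_tendsto:
  assumes eig: "\<And>z. mat_eigenvalue Abar z \<Longrightarrow> Re z < 0 \<and> cmod (1 + z) < 1"
  shows "\<exists>S11 S22.
           (state_cov M \<theta> \<theta>s \<longlonglongrightarrow> block_matrix S11 0 0 S22) \<and>
           pos_semidef S22 \<and>
           S22 = G ** S22 ** transpose G + noise_cov M A b \<theta>s \<and>
           (\<forall>X. X = G ** X ** transpose G + noise_cov M A b \<theta>s \<longrightarrow> X = S22) \<and>
           S11 = - S22 - matrix_inv Abar ** S22 - S22 ** transpose (matrix_inv Abar) \<and>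
           S11 = matrix_inv Abar ** noise_cov M A b \<theta>s ** transpose (matrix_inv Abar)"
proof -
  let ?S = "noise_cov M A b \<theta>s"
  let ?J = "matrix_inv Abar"
  obtain K where K: "\<And>n. l2_norm M (scaled_err n) \<le> K" "\<And>n. l2_norm M (scaled_incr n) \<le> K"
    using l2_norms_bounded by metis
  have norm_le: "norm (cross_moment M X Y) \<le> K * K"
    if "ess_bounded M M X" "ess_bounded M M Y" "l2_norm M X \<le> K" "l2_norm M Y \<le> K"
    for X Y :: "'w \<Rightarrow> real ^ 'd"
    using norm_cross_moment_le[OF that(1,2)] mult_mono[OF that(3,4)] that(3)
    by (meson l2_norm_nonneg order_trans)
  have pow: "mat_power G \<longlonglongrightarrow> 0"
  proof (rule mat_power_tendsto_0)
    fix z assume "mat_eigenvalue G z"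
    then have "cmod (1 + (z - 1)) < 1" using eig unfolding mat_eigenvalue_mat_1_plus by blast
    then show "cmod z < 1" by simp
  qed
  \<comment> \<open>Zero is excluded by the negative real parts, so \<open>matrix_inv Abar\<close>
    is a genuine inverse.\<close>
  have "\<not> mat_eigenvalue Abar 0" using eig[of 0] by auto
  note inv = matrix_inv_if_no_zero_eigenvalue[OF this]
  have inv': "transpose Abar ** transpose ?J = mat 1"
    using arg_cong[OF inv(1), of transpose] by (simp add: matrix_transpose_mul)
  obtain S22 where S22: "S22 = G ** S22 ** transpose G + ?S"
    and unique: "\<And>X. X = G ** X ** transpose G + ?S \<Longrightarrow> X = S22"
    using ex1_lyapunov_solution[OF pow, of ?S] by blast
  have lim22: "(\<lambda>n. cross_moment M (scaled_incr n) (scaled_incr n)) \<longlonglongrightarrow> S22"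
    by (rule perturbed_lyapunov_tendsto[OF pow norm_le scaled_incr_cov_recursion S22])
      (rule ess_bounded_global K)+
  have lim12: "(\<lambda>n. cross_moment M (scaled_err n) (scaled_incr n)) \<longlonglongrightarrow> 0"
    by (rule perturbed_right_mult_tendsto_0[OF pow norm_le cross_cov_recursion])
      (rule ess_bounded_global K)+
  have "(\<lambda>n. transpose (cross_moment M (scaled_err n) (scaled_incr n))) \<longlonglongrightarrow> transpose 0"
    by (rule tendsto_transpose[OF lim12])
  then have lim21: "(\<lambda>n. cross_moment M (scaled_incr n) (scaled_err n)) \<longlonglongrightarrow> 0"
    by (simp add: transpose_cross_moment ess_bounded_global)
      (simp add: transpose_def zero_vec_def)
  have cancel: "?J ** (Abar ** X ** transpose Abar) ** transpose ?J = X" for X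
    by (simp add: matrix_mul_assoc inv) (simp add: inv' flip: matrix_mul_assoc)
  have "(\<lambda>n. ?J ** (Abar ** cross_moment M (scaled_err n) (scaled_err n) ** transpose Abar) ** transpose ?J)
      \<longlonglongrightarrow> ?J ** ?S ** transpose ?J"
    by (intro tendsto_matrix_mult tendsto_const scaled_err_cov_tendsto)
  then have lim11: "(\<lambda>n. cross_moment M (scaled_err n) (scaled_err n)) \<longlonglongrightarrow> ?J ** ?S ** transpose ?J"
    by (simp only: cancel)
  have lim: "state_cov M \<theta> \<theta>s \<longlonglongrightarrow> block_matrix (?J ** ?S ** transpose ?J) 0 0 S22"
    unfolding state_cov_blocks[abs_def] by (rule block_matrix_tendsto[OF lim11 lim12 lim21 lim22])
  \<comment> \<open>Semidefiniteness is inherited from the covariances of which \<open>S22\<close>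
    is the limit.\<close>
  have psd: "pos_semidef S22"
    by (rule pos_semidef_limit[OF lim22 pos_semidef_cross_moment[OF ess_bounded_global(5)]])
  have "?J ** ?S ** transpose ?J = - S22 - ?J ** S22 - S22 ** transpose ?J"
  proof -
    have "?S = S22 - G ** S22 ** transpose G" by (subst (1) S22) simp
    \<comment> \<open>Expanding \<open>G = mat 1 + Abar\<close> cancels \<open>S22\<close>.
      Multiplication by the inverse on the left and its transpose on the right then turns the three
      remaining products into those of the claim.\<close>
    also have "\<dots> = - (Abar ** S22) - S22 ** transpose Abar - Abar ** S22 ** transpose Abar"
      by (simp add: transpose_add transpose_mat matrix_add_ldistrib bounded_bilinear.add_left[OF bounded_bilinear_matrix_mult]
          matrix_mul_assoc)
    finally have "?J ** ?S ** transpose ?J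
      = - (?J ** (Abar ** S22) ** transpose ?J) - ?J ** (S22 ** transpose Abar) ** transpose ?J
        - ?J ** (Abar ** S22 ** transpose Abar) ** transpose ?J"
      by (simp only: bounded_bilinear.diff_left[OF bounded_bilinear_matrix_mult]
          bounded_bilinear.diff_right[OF bounded_bilinear_matrix_mult]
          bounded_bilinear.minus_left[OF bounded_bilinear_matrix_mult]
          bounded_bilinear.minus_right[OF bounded_bilinear_matrix_mult])
    also have "?J ** (Abar ** S22) ** transpose ?J = S22 ** transpose ?J"
      by (simp add: matrix_mul_assoc inv)
    also have "?J ** (S22 ** transpose Abar) ** transpose ?J = ?J ** S22"
      by (simp add: inv' flip: matrix_mul_assoc)
    finally show ?thesis unfolding cancel by simp
  qed
  with lim psd S22 unique show ?thesis by blast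
qed

end

end

theorem proposition4:
  fixes M :: "'w measure"
    and A :: "nat \<Rightarrow> 'w \<Rightarrow> real ^ 'd ^ 'd" and b :: "nat \<Rightarrow> 'w \<Rightarrow> real ^ 'd"
    and Abar :: "real ^ 'd ^ 'd" and bbar \<theta>s \<theta>0 :: "real ^ 'd"
    and \<theta> :: "nat \<Rightarrow> 'w \<Rightarrow> real ^ 'd"
  assumes "prob_space M"
    and "wide_sense_stationary M (\<lambda>n \<omega>. (A n \<omega>, b n \<omega>))"
    and "\<And>n. n \<ge> 1 \<Longrightarrow> integral\<^sup>L M (A n) = Abar"
    and "\<And>n. n \<ge> 1 \<Longrightarrow> integral\<^sup>L M (b n) = bbar"
    and "Abar *v \<theta>s = bbar"
    and "polsa M A b Abar \<theta>0 \<theta>"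
    and N1_A: "bounded_process M (\<lambda>n \<omega>. A n \<omega> - Abar)"
              "martingale_difference M (filt M A b) (\<lambda>n \<omega>. A n \<omega> - Abar)"
    and N1_b: "bounded_process M (\<lambda>n \<omega>. b n \<omega> - bbar)"
              "martingale_difference M (filt M A b) (\<lambda>n \<omega>. b n \<omega> - bbar)"
    and N1_L: "\<And>n Q. n \<ge> 1 \<Longrightarrow>
                 cond_exp_eq M (filt M A b (n - 1))
                   (\<lambda>\<omega>. (mat 1 + A n \<omega>) ** Q ** transpose (mat 1 + A n \<omega>))
                   (\<lambda>\<omega>. lyap_op M A Q)"
    and N2_A: "\<And>z. mat_eigenvalue Abar z \<Longrightarrow> Re z < 0 \<and> cmod (1 + z) < 1"
    and N2_L: "op_spectral_radius (lyap_op M A) < 1"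
    and N3: "bounded (range (state_cov M \<theta> \<theta>s))"
  shows "\<exists>S11 S22.
           (state_cov M \<theta> \<theta>s \<longlonglongrightarrow> block_matrix S11 0 0 S22) \<and>
           pos_semidef S22 \<and>
           S22 = (mat 1 + Abar) ** S22 ** transpose (mat 1 + Abar) + noise_cov M A b \<theta>s \<and>
           (\<forall>X. X = (mat 1 + Abar) ** X ** transpose (mat 1 + Abar) + noise_cov M A b \<theta>s
                \<longrightarrow> X = S22) \<and>
           S11 = - S22 - matrix_inv Abar ** S22 - S22 ** transpose (matrix_inv Abar) \<and>
           S11 = matrix_inv Abar ** noise_cov M A b \<theta>s ** transpose (matrix_inv Abar)"
proof -
  interpret polsa_model M A b Abar bbar \<theta>s \<theta>0 \<theta>
    by (intro polsa_model.intro polsa_model_axioms.intro assms)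
  show ?thesis by (rule state_cov_tendsto[OF N3 N2_A])
qed

end
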